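(* Let $K$ and $M$ be integers with $2\le M\le K$. For the PIR-PCSI--II setting with $K$ messages and side information support size $M$: the capacity equals $(K-M+1)^{-1}$ whenever $\frac{K+1}{2}<M\le K$, and the capacity is at least $(K-M+1)^{-1}$ whenever $2\le M\le\frac{K+1}{2}$. Moreover, the scalar-linear capacity equals $(K-M+1)^{-1}$ for all $2\le M\le K$.
   Context: Setup. Let $\mathcal{K}=\{1,\dots,K\}$, let $q$ be a prime power, $l\ge 1$ an integer, $\mathbb{F}_q^{\times}=\mathbb{F}_q\setminus\{0\}$ and $L=l\log_2 q$. Let $\mathcal{S}$ be the set of all $M$-subsets of $\mathcal{K}$ and $\mathcal{C}$ the set of all length-$M$ sequences over $\mathbb{F}_q^{\times}$. Boldface denotes random variables, regular letters their realizations; entropies are Shannon entropies in bits. A server stores messages $\mathbf{X}_1,\dots,\mathbf{X}_K$, i.i.d. uniform on $\mathbb{F}_{q^l}$ (so $H(\mathbf{X}_i)=L$); write $\mathbf{X}_{\mathcal{K}}=\{\mathbf{X}_1,\dots,\mathbf{X}_K\}$. A user wants $X_W$ ($W\in\mathcal{K}$ is the demand index) and knows the coded side information $Y^{[S,C]}=\sum_{i\in S}c_iX_i$, where $S=\{i_1,\dots,i_M\}\in\mathcal{S}$ (the support index set) and $C=(c_{i_1},\dots,c_{i_M})\in\mathcal{C}$. $\mathbf{S}$ is uniform on $\mathcal{S}$, $\mathbf{C}$ is uniform on $\mathcal{C}$ and independent of $(\mathbf{W},\mathbf{S})$, and the messages are independent of $(\mathbf{W},\mathbf{S},\mathbf{C})$.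 Model II: given $\mathbf{S}=S$, $\mathbf{W}$ is uniform on $S$ (so the indicator $\mathds{1}_{\{\mathbf{W}\in\mathbf{S}\}}$ equals $1$). Protocol. The user sends a query $\mathbf{Q}=\mathbf{Q}^{[\mathbf{W},\mathbf{S},\mathbf{C}]}$, a possibly stochastic function of $(\mathbf{W},\mathbf{S},\mathbf{C})$ only (any extra randomness is independent of the messages). The server replies with an answer $\mathbf{A}=\mathbf{A}^{[\mathbf{W},\mathbf{S},\mathbf{C}]}$, a deterministic function of $\mathbf{Q}$, the indicator $\mathds{1}_{\{\mathbf{W}\in\mathbf{S}\}}$ and $\mathbf{X}_{\mathcal{K}}$. Recoverability: $H(\mathbf{X}_{\mathbf{W}}\mid \mathbf{A},\mathbf{Q},\mathds{1}_{\{\mathbf{W}\in\mathbf{S}\}},\mathbf{Y}^{[\mathbf{S},\mathbf{C}]},\mathbf{W},\mathbf{S},\mathbf{C})=0$. $(W,S)$-privacy: $I(\mathbf{W},\mathbf{S};\mathbf{Q}\mid \mathds{1}_{\{\mathbf{W}\in\mathbf{S}\}})=0$. A PIR-PCSI--II protocol is a protocol under Model II satisfying recoverability and $(W,S)$-privacy. Its rate is $L/H(\mathbf{A}\mid \mathds{1}_{\{\mathbf{W}\in\mathbf{S}\}}=1)$. It is scalar-linear if the answer consists only of linear combinations of $X_1,\dots,X_K$ with coefficients in $\mathbb{F}_q$ (the coefficients being determined by the query). The capacity (resp. scalar-linear capacity) of the setting is the supremum of the rates over all (resp. all scalar-linear) PIR-PCSI--II protocols and over all prime powers $q$ and all $l\ge1$.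 *)

theory Defs
  imports "HOL-Probability.Probability" "HOL-Algebra.Subrings" "HOL-Number_Theory.Prime_Powers"
begin

text \<open>
  The sample space is cut down to the (countable) support of \<open>P\<close>, so that every function on it is a
  discrete random variable and \<^const>\<open>count_space\<close> on its range is sigma-finite, as the library's
  information measures need.
\<close>

definition supp_space :: "'a pmf \<Rightarrow> 'a measure" where
  "supp_space P = restrict_space (measure_pmf P) (set_pmf P)"

definition range_space :: "'a pmf \<Rightarrow> ('a \<Rightarrow> 'b) \<Rightarrow> 'b measure" where
  "range_space P X = count_space (X ` space (supp_space P))"

lemma space_supp_space [simp]: "space (supp_space P) = set_pmf P"
  by (simp add: supp_space_def space_restrict_space)

lemma information_space_supp_space: "information_space (supp_space P) 2"
proof -
  have "emeasure (measure_pmf P) (set_pmf P) = 1"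
    by (simp add: measure_pmf.emeasure_eq_1_AE AE_measure_pmf)
  then have "prob_space (supp_space P)"
    unfolding supp_space_def by (intro prob_space_restrict_space) simp_all
  then show ?thesis
    by (simp add: information_space_def information_space_axioms_def)
qed

lemma distributed_supp_space:
  "distributed (supp_space P) (range_space P X) X (\<lambda>x. ennreal (pmf (map_pmf X P) x))"
proof -
  have sets: "sets (supp_space P) = Pow (set_pmf P)"
    by (auto simp: supp_space_def sets_restrict_space)
  have meas: "X \<in> measurable (supp_space P) (range_space P X)"
    by (auto simp: measurable_def range_space_def sets)
  have "distr (supp_space P) (range_space P X) X =
      density (range_space P X) (\<lambda>x. ennreal (pmf (map_pmf X P) x))"
  proof (rule measure_eqI)
    fix A assume "A \<in> sets (distr (supp_space P) (range_space P X) X)"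
    then have A: "A \<subseteq> X ` set_pmf P" by (simp add: range_space_def)
    have "emeasure (distr (supp_space P) (range_space P X) X) A =
        emeasure (supp_space P) (X -` A \<inter> set_pmf P)"
      using A meas by (subst emeasure_distr) (auto simp: range_space_def)
    also have "\<dots> = emeasure (measure_pmf P) (X -` A \<inter> set_pmf P)"
      by (simp add: supp_space_def emeasure_restrict_space)
    also have "\<dots> = emeasure (measure_pmf (map_pmf X P)) A"
      by (simp add: emeasure_Int_set_pmf)
    also have "\<dots> = (\<integral>\<^sup>+x. ennreal (pmf (map_pmf X P) x) \<partial>count_space A)"
      by (simp add: nn_integral_pmf)
    also have "\<dots> = emeasure (density (range_space P X) (\<lambda>x. ennreal (pmf (map_pmf X P) x))) A"
      using A by (subst emeasure_density)
        (auto simp: range_space_def nn_integral_count_space_indicator nn_integral_restrict_space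
          intro!: nn_integral_cong split: split_indicator)
    finally show "emeasure (distr (supp_space P) (range_space P X) X) A =
      emeasure (density (range_space P X) (\<lambda>x. ennreal (pmf (map_pmf X P) x))) A" .
  qed simp
  with meas show ?thesis
    by (simp add: distributed_def range_space_def)
qed

definition conditional_entropy_bits :: "'a pmf \<Rightarrow> ('a \<Rightarrow> 'b) \<Rightarrow> ('a \<Rightarrow> 'c) \<Rightarrow> real" where
  "conditional_entropy_bits P X Y =
     prob_space.conditional_entropy (supp_space P) 2 (range_space P X) (range_space P Y) X Y"

definition conditional_mutual_information_bits ::
    "'a pmf \<Rightarrow> ('a \<Rightarrow> 'b) \<Rightarrow> ('a \<Rightarrow> 'c) \<Rightarrow> ('a \<Rightarrow> 'd) \<Rightarrow> real" where
  "conditional_mutual_information_bits P X Y Z =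
     prob_space.conditional_mutual_information (supp_space P) 2
       (range_space P X) (range_space P Y) (range_space P Z) X Y Z"

text \<open>
  Queries may have infinite support, so the entropy of an answer may diverge, whereas the library's
  entropy is real-valued, with the value 0 on divergence. Hence the explicit value \<open>\<infinity>\<close>.
\<close>

definition entropy_bits :: "'a pmf \<Rightarrow> ('a \<Rightarrow> 'b) \<Rightarrow> ereal" where
  "entropy_bits P X =
     (if information_space.finite_entropy (supp_space P) 2 (range_space P X) X (pmf (map_pmf X P))
      then ereal (prob_space.entropy (supp_space P) 2 (range_space P X) X)
      else \<infinity>)"

definition entropy_given_event :: "'a pmf \<Rightarrow> ('a \<Rightarrow> 'b) \<Rightarrow> 'a set \<Rightarrow> ereal" where
  "entropy_given_event P X E = entropy_bits (cond_pmf P E) X"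

text \<open>
  \<open>R\<close> is the field with \<open>q ^ l\<close> elements and \<open>F\<close> its subfield with \<open>q\<close> elements. Carriers consisting
  of integers lose no generality, since every finite field has such a copy.
\<close>

definition field_pair :: "nat \<Rightarrow> nat \<Rightarrow> int ring \<Rightarrow> int set \<Rightarrow> bool" where
  "field_pair q l R F \<longleftrightarrow>
     primepow q \<and> 1 \<le> l \<and> field R \<and> subfield F R \<and> card F = q \<and> card (carrier R) = q ^ l"

definition supports :: "nat \<Rightarrow> nat \<Rightarrow> nat set set" where
  "supports K M = {S. S \<subseteq> {1..K} \<and> card S = M}"

definition coefficient_seqs :: "nat \<Rightarrow> int ring \<Rightarrow> int set \<Rightarrow> int list set" where
  "coefficient_seqs M R F = {C. length C = M \<and> set C \<subseteq> F - {\<zero>\<^bsub>R\<^esub>}}"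

text \<open>The \<open>j\<close>-th coefficient belongs to the \<open>j\<close>-th smallest index in \<open>S\<close>.\<close>

definition side_info :: "int ring \<Rightarrow> nat set \<Rightarrow> int list \<Rightarrow> (nat \<Rightarrow> int) \<Rightarrow> int" where
  "side_info R S C X =
     (\<Oplus>\<^bsub>R\<^esub>j\<in>{..<card S}. (C ! j) \<otimes>\<^bsub>R\<^esub> X (sorted_list_of_set S ! j))"

record outcome =
  rv_W :: nat
  rv_S :: "nat set"
  rv_C :: "int list"
  rv_Q :: nat
  rv_X :: "nat \<Rightarrow> int"

abbreviation rv_ind :: "outcome \<Rightarrow> bool" where
  "rv_ind \<omega> \<equiv> rv_W \<omega> \<in> rv_S \<omega>"

text \<open>
  Queries and answers range over the countable types \<^typ>\<open>nat\<close> and \<^typ>\<open>int list\<close>, into which any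
  discrete alphabet can be encoded. The randomness of the query is that of \<open>query W S C\<close>; the messages
  are drawn independently of everything else.
\<close>

type_synonym query_fun = "nat \<Rightarrow> nat set \<Rightarrow> int list \<Rightarrow> nat pmf"
type_synonym answer_fun = "nat \<Rightarrow> bool \<Rightarrow> (nat \<Rightarrow> int) \<Rightarrow> int list"

definition model_II :: "nat \<Rightarrow> nat \<Rightarrow> int ring \<Rightarrow> int set \<Rightarrow> query_fun \<Rightarrow> outcome pmf" where
  "model_II K M R F query = do {
     S \<leftarrow> pmf_of_set (supports K M);
     W \<leftarrow> pmf_of_set S;
     C \<leftarrow> pmf_of_set (coefficient_seqs M R F);
     Q \<leftarrow> query W S C;
     X \<leftarrow> Pi_pmf {1..K} undefined (\<lambda>_. pmf_of_set (carrier R));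
     return_pmf \<lparr>rv_W = W, rv_S = S, rv_C = C, rv_Q = Q, rv_X = X\<rparr>
   }"

definition rv_Y :: "int ring \<Rightarrow> outcome \<Rightarrow> int" where
  "rv_Y R \<omega> = side_info R (rv_S \<omega>) (rv_C \<omega>) (rv_X \<omega>)"

definition rv_A :: "answer_fun \<Rightarrow> outcome \<Rightarrow> int list" where
  "rv_A answer \<omega> = answer (rv_Q \<omega>) (rv_ind \<omega>) (rv_X \<omega>)"

definition recoverability ::
    "nat \<Rightarrow> nat \<Rightarrow> int ring \<Rightarrow> int set \<Rightarrow> query_fun \<Rightarrow> answer_fun \<Rightarrow> bool" where
  "recoverability K M R F query answer \<longleftrightarrow>
     conditional_entropy_bits (model_II K M R F query)
       (\<lambda>\<omega>. rv_X \<omega> (rv_W \<omega>))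
       (\<lambda>\<omega>. (rv_A answer \<omega>, rv_Q \<omega>, rv_ind \<omega>, rv_Y R \<omega>, rv_W \<omega>, rv_S \<omega>, rv_C \<omega>)) = 0"

definition WS_privacy :: "nat \<Rightarrow> nat \<Rightarrow> int ring \<Rightarrow> int set \<Rightarrow> query_fun \<Rightarrow> bool" where
  "WS_privacy K M R F query \<longleftrightarrow>
     conditional_mutual_information_bits (model_II K M R F query)
       (\<lambda>\<omega>. (rv_W \<omega>, rv_S \<omega>)) rv_Q rv_ind = 0"

definition pir_pcsi_II ::
    "nat \<Rightarrow> nat \<Rightarrow> int ring \<Rightarrow> int set \<Rightarrow> query_fun \<Rightarrow> answer_fun \<Rightarrow> bool" where
  "pir_pcsi_II K M R F query answer \<longleftrightarrow>
     recoverability K M R F query answer \<and> WS_privacy K M R F query"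

text \<open>Each entry of \<open>G Q\<close> is the coefficient vector of one symbol of the answer to the query \<open>Q\<close>.\<close>

definition scalar_linear ::
    "nat \<Rightarrow> nat \<Rightarrow> int ring \<Rightarrow> int set \<Rightarrow> query_fun \<Rightarrow> answer_fun \<Rightarrow> bool" where
  "scalar_linear K M R F query answer \<longleftrightarrow>
     (\<exists>G :: nat \<Rightarrow> (nat \<Rightarrow> int) list.
        (\<forall>Q. \<forall>g\<in>set (G Q). \<forall>i\<in>{1..K}. g i \<in> F) \<and>
        (\<forall>\<omega>\<in>set_pmf (model_II K M R F query).
           rv_A answer \<omega> =
             map (\<lambda>g. \<Oplus>\<^bsub>R\<^esub>i\<in>{1..K}. g i \<otimes>\<^bsub>R\<^esub> rv_X \<omega> i) (G (rv_Q \<omega>))))"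

text \<open>Division in \<^typ>\<open>ereal\<close> gives rate 0 for an answer of infinite entropy.\<close>

definition rate ::
    "nat \<Rightarrow> nat \<Rightarrow> nat \<Rightarrow> nat \<Rightarrow> int ring \<Rightarrow> int set \<Rightarrow> query_fun \<Rightarrow> answer_fun \<Rightarrow> ereal" where
  "rate K M q l R F query answer =
     ereal (real l * log 2 (real q)) /
     entropy_given_event (model_II K M R F query) (rv_A answer) {\<omega>. rv_ind \<omega>}"

definition capacity :: "nat \<Rightarrow> nat \<Rightarrow> ereal" where
  "capacity K M = Sup {rate K M q l R F query answer | q l R F query answer.
     field_pair q l R F \<and> pir_pcsi_II K M R F query answer}"

definition scalar_linear_capacity :: "nat \<Rightarrow> nat \<Rightarrow> ereal" where
  "scalar_linear_capacity K M = Sup {rate K M q l R F query answer | q l R F query answer.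
     field_pair q l R F \<and> pir_pcsi_II K M R F query answer \<and>
     scalar_linear K M R F query answer}"

end

theory Submission
  imports Defs "HOL-Number_Theory.Residues"
begin

text \<open>
  Privacy makes every query that occurs compatible with every pair of a demand \<open>W\<close> and a support
  \<open>S\<close>, so the answer to a fixed query must allow decoding \<open>X W\<close> from some side information on \<open>S\<close>,
  for all \<open>S\<close> and \<open>W \<in> S\<close> at once. Such an answer has small fibres as a function of the messages,
  which bounds its probabilities and hence its entropy from below. Conversely, a query that is a
  uniformly random tuple of column multipliers of a generalised Reed-Solomon code of dimension
  \<open>K - M + 1\<close> is independent of \<open>W\<close> and \<open>S\<close>; the multipliers are coupled to the side information so
  that the code contains a codeword with support \<open>S\<close> which equals the side information
  coefficients except at \<open>W\<close>.
\<close>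

section \<open>Information measures as expectations\<close>

text \<open>For each \<open>W\<close> and \<open>S\<close>, privacy only yields some coefficients
  under which the query occurs. They may change with \<open>W\<close> as well as \<open>S\<close>,
  and nothing is known of them except that they are nonzero. Without linearity, the fibre argument
  replaces one of \<open>M - 1\<close> free coordinates by a side information for each of
  \<open>K - M + 1\<close> messages, so it needs \<open>K - M + 1 \<le> M - 1\<close>; this is the
  origin of \<open>K + 2 \<le> 2 * M\<close>. For linear answers the kernel is closed under
  combinations, and two of its vectors defeat any choice of nonzero coefficients.

  In the scheme, the side information minus the codeword combination is a nonzero multiple of
  \<open>X W\<close>. The factor at \<open>W\<close> must therefore be neither 0 nor 1; 2 qualifies
  modulo a prime \<open>p > K\<close>, which also keeps the evaluation points
  \<open>1, \<dots>, K\<close> distinct. A prime field with \<open>l = 1\<close> is enough, since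
  the capacity is a supremum over fields.

  The integral of a non-integrable function is 0 by convention, and queries may have infinite
  support. So a vanishing information measure says something only once integrability is known; the
  finite ranges of the messages and of \<open>(W, S)\<close> provide it.\<close>

lemma
  fixes f :: "'a \<Rightarrow> real"
  assumes "set_pmf q \<subseteq> A"
  shows integrable_count_space_pmf:
      "integrable (count_space A) (\<lambda>x. pmf q x * f x) \<longleftrightarrow> integrable (measure_pmf q) f" (is ?A)
    and integral_count_space_pmf:
      "(\<integral>x. pmf q x * f x \<partial>count_space A) = measure_pmf.expectation q f" (is ?B)
proof -
  have A: "count_space A = restrict_space (count_space UNIV) A"
    by (simp add: restrict_count_space)
  have eq: "(\<lambda>x. indicator A x * (pmf q x * f x)) = (\<lambda>x. pmf q x * f x)"
    using assms by (auto simp: fun_eq_iff indicator_def set_pmf_iff)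
  show ?A
    unfolding A by (subst integrable_restrict_space)
      (simp_all add: eq measure_pmf_eq_density integrable_density)
  show ?B
    unfolding A by (subst integral_restrict_space)
      (simp_all add: eq measure_pmf_eq_density integral_density)
qed

text \<open>Extends \<open>distributed_supp_space\<close> to a target larger than the range: a pair
  takes its values in the product of the two ranges, which it need not fill.\<close>

lemma distributed_supp_space_count_space:
  assumes "countable A" "X ` set_pmf P \<subseteq> A"
  shows "distributed (supp_space P) (count_space A) X (\<lambda>x. ennreal (pmf (map_pmf X P) x))"
proof -
  have sets: "sets (supp_space P) = Pow (set_pmf P)"
    by (auto simp: supp_space_def sets_restrict_space)
  have meas: "X \<in> measurable (supp_space P) (count_space A)"
    using assms by (auto simp: measurable_def sets)
  have "distr (supp_space P) (count_space A) X =
      density (count_space A) (\<lambda>x. ennreal (pmf (map_pmf X P) x))"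
  proof (rule measure_eqI)
    fix B assume "B \<in> sets (distr (supp_space P) (count_space A) X)"
    then have B: "B \<subseteq> A" by simp
    have "emeasure (distr (supp_space P) (count_space A) X) B =
        emeasure (supp_space P) (X -` B \<inter> set_pmf P)"
      using B meas by (subst emeasure_distr) auto
    also have "\<dots> = emeasure (measure_pmf P) (X -` B \<inter> set_pmf P)"
      by (simp add: supp_space_def emeasure_restrict_space)
    also have "\<dots> = emeasure (measure_pmf (map_pmf X P)) B"
      by (simp add: emeasure_Int_set_pmf)
    also have "\<dots> = (\<integral>\<^sup>+x. ennreal (pmf (map_pmf X P) x) \<partial>count_space B)"
      by (simp add: nn_integral_pmf)
    also have "\<dots> = emeasure (density (count_space A) (\<lambda>x. ennreal (pmf (map_pmf X P) x))) B"
      using B by (subst emeasure_density)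
        (auto simp: nn_integral_count_space_indicator nn_integral_restrict_space
          intro!: nn_integral_cong split: split_indicator)
    finally show "emeasure (distr (supp_space P) (count_space A) X) B =
      emeasure (density (count_space A) (\<lambda>x. ennreal (pmf (map_pmf X P) x))) B" .
  qed simp
  with meas show ?thesis
    by (simp add: distributed_def)
qed

lemma range_space_pair:
  "range_space P X \<Otimes>\<^sub>M range_space P Y = count_space (X ` set_pmf P \<times> Y ` set_pmf P)"
  by (simp add: range_space_def pair_measure_countable)

lemma sigma_finite_range_space: "sigma_finite_measure (range_space P X)"
  by (simp add: range_space_def sigma_finite_measure_count_space_countable)

lemma conditional_entropy_bits_eq:
  "conditional_entropy_bits P X Y =
     - measure_pmf.expectation P (\<lambda>\<omega>. log 2 (pmf (map_pmf (\<lambda>\<omega>. (X \<omega>, Y \<omega>)) P) (X \<omega>, Y \<omega>)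
         / pmf (map_pmf Y P) (Y \<omega>)))"
proof -
  interpret information_space "supp_space P" 2 by (rule information_space_supp_space)
  let ?q = "map_pmf (\<lambda>\<omega>. (X \<omega>, Y \<omega>)) P"
  have d: "distributed (supp_space P) (range_space P X \<Otimes>\<^sub>M range_space P Y) (\<lambda>\<omega>. (X \<omega>, Y \<omega>))
      (\<lambda>x. ennreal (pmf ?q x))"
    unfolding range_space_pair by (rule distributed_supp_space_count_space) auto
  have "conditional_entropy_bits P X Y =
      - (\<integral>z. pmf ?q z * log 2 (pmf ?q z / pmf (map_pmf Y P) (snd z))
          \<partial>(range_space P X \<Otimes>\<^sub>M range_space P Y))"
    unfolding conditional_entropy_bits_def
    by (subst conditional_entropy_generic_eq[OF sigma_finite_range_space sigma_finite_range_space
          distributed_supp_space _ d]) (simp_all add: split_beta')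
  then show ?thesis
    unfolding range_space_pair by (subst (asm) integral_count_space_pmf) auto
qed

text \<open>The second space is left general because conditional mutual information puts the product
  space of \<open>Y\<close> and \<open>Z\<close> there.\<close>

lemma mutual_information_range_space:
  assumes "countable B" "Y ` set_pmf P \<subseteq> B"
  shows "prob_space.mutual_information (supp_space P) 2 (range_space P X) (count_space B) X Y =
     measure_pmf.expectation P (\<lambda>\<omega>. log 2 (pmf (map_pmf (\<lambda>\<omega>. (X \<omega>, Y \<omega>)) P) (X \<omega>, Y \<omega>)
         / (pmf (map_pmf X P) (X \<omega>) * pmf (map_pmf Y P) (Y \<omega>))))"
proof -
  interpret information_space "supp_space P" 2 by (rule information_space_supp_space)
  let ?q = "map_pmf (\<lambda>\<omega>. (X \<omega>, Y \<omega>)) P"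
  have eq: "range_space P X \<Otimes>\<^sub>M count_space B = count_space (X ` set_pmf P \<times> B)"
    using assms by (simp add: range_space_def pair_measure_countable)
  have d: "distributed (supp_space P) (range_space P X \<Otimes>\<^sub>M count_space B) (\<lambda>\<omega>. (X \<omega>, Y \<omega>))
      (\<lambda>x. ennreal (pmf ?q x))"
    unfolding eq using assms by (intro distributed_supp_space_count_space) auto
  have "prob_space.mutual_information (supp_space P) 2 (range_space P X) (count_space B) X Y =
      (\<integral>z. pmf ?q z * log 2 (pmf ?q z / (pmf (map_pmf X P) (fst z) * pmf (map_pmf Y P) (snd z)))
          \<partial>(range_space P X \<Otimes>\<^sub>M count_space B))"
    using assms
    by (subst mutual_information_distr[OF sigma_finite_range_space _
          distributed_supp_space _ distributed_supp_space_count_space _ d])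
      (simp_all add: case_prod_beta sigma_finite_measure_count_space_countable)
  then show ?thesis
    unfolding eq using assms by (subst (asm) integral_count_space_pmf) auto
qed

text \<open>By definition I(X;Y|Z) is I(X;Y,Z) - I(X;Z). A constant \<open>Z\<close> leaves the
  first term equal to I(X;Y) and makes the second vanish. In Model II the indicator is such a
  \<open>Z\<close>.\<close>

lemma conditional_mutual_information_bits_const:
  assumes Z: "\<And>\<omega>. \<omega> \<in> set_pmf P \<Longrightarrow> Z \<omega> = c"
  shows "conditional_mutual_information_bits P X Y Z =
     measure_pmf.expectation P (\<lambda>\<omega>. log 2 (pmf (map_pmf (\<lambda>\<omega>. (X \<omega>, Y \<omega>)) P) (X \<omega>, Y \<omega>)
         / (pmf (map_pmf X P) (X \<omega>) * pmf (map_pmf Y P) (Y \<omega>))))"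
proof -
  interpret information_space "supp_space P" 2 by (rule information_space_supp_space)
  have YZ: "map_pmf (\<lambda>\<omega>. (Y \<omega>, Z \<omega>)) P = map_pmf (\<lambda>y. (y, c)) (map_pmf Y P)"
    unfolding map_pmf_comp using Z by (intro map_pmf_cong) auto
  have XZ: "map_pmf (\<lambda>\<omega>. (X \<omega>, Z \<omega>)) P = map_pmf (\<lambda>y. (y, c)) (map_pmf X P)"
    unfolding map_pmf_comp using Z by (intro map_pmf_cong) auto
  have XYZ: "map_pmf (\<lambda>\<omega>. (X \<omega>, Y \<omega>, Z \<omega>)) P =
      map_pmf (\<lambda>(x, y). (x, y, c)) (map_pmf (\<lambda>\<omega>. (X \<omega>, Y \<omega>)) P)"
    unfolding map_pmf_comp using Z by (intro map_pmf_cong) auto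
  have "map_pmf Z P = map_pmf (\<lambda>_. c) P"
    using Z by (intro map_pmf_cong) auto
  then have Zc: "map_pmf Z P = return_pmf c" by simp
  have p: "pmf (map_pmf (\<lambda>y. (y, c)) q) (y, c) = pmf q y" for q and y :: 'z
    by (rule pmf_map_inj') (auto simp: inj_on_def)
  have p': "pmf (map_pmf (\<lambda>(x, y). (x, y, c)) q) (x, y, c) = pmf q (x, y)" for q and x :: 'z and y :: 'w
    using pmf_map_inj'[of "\<lambda>(x, y). (x, y, c)" q "(x, y)"] by (auto simp: inj_on_def)
  have 1: "prob_space.mutual_information (supp_space P) 2 (range_space P X)
        (range_space P Y \<Otimes>\<^sub>M range_space P Z) X (\<lambda>\<omega>. (Y \<omega>, Z \<omega>)) =
      measure_pmf.expectation P (\<lambda>\<omega>. log 2 (pmf (map_pmf (\<lambda>\<omega>. (X \<omega>, Y \<omega>)) P) (X \<omega>, Y \<omega>)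
         / (pmf (map_pmf X P) (X \<omega>) * pmf (map_pmf Y P) (Y \<omega>))))"
    unfolding range_space_pair
    by (subst mutual_information_range_space)
      (auto simp: XYZ YZ p p' Z AE_measure_pmf_iff intro!: integral_cong_AE)
  have 2: "prob_space.mutual_information (supp_space P) 2 (range_space P X) (range_space P Z) X Z = 0"
    unfolding range_space_def[of P Z]
    by (subst mutual_information_range_space)
      (auto simp: XZ Zc p Z AE_measure_pmf_iff set_pmf_iff[symmetric] pmf_eq_0_set_pmf intro!: integral_eq_zero_AE)
  show ?thesis
    unfolding conditional_mutual_information_bits_def conditional_mutual_information_def 1 2 by simp
qed

section \<open>Relative entropy and the meaning of vanishing information measures\<close>

lemma
  fixes q s :: "'a pmf"
  shows integrable_pmf_ratio: "integrable (measure_pmf q) (\<lambda>z. pmf s z / pmf q z)" (is ?A)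
    and expectation_pmf_ratio:
      "measure_pmf.expectation q (\<lambda>z. pmf s z / pmf q z) = measure_pmf.prob s (set_pmf q)" (is ?B)
proof -
  have "integrable (count_space (set_pmf q)) (\<lambda>z. pmf q z * (pmf s z / pmf q z)) \<longleftrightarrow>
      integrable (count_space (set_pmf q)) (pmf s)"
    by (rule Bochner_Integration.integrable_cong) (simp_all add: set_pmf_iff)
  then show ?A
    by (subst (asm) integrable_count_space_pmf) (simp_all add: integrable_pmf)
  have "(\<integral>z. pmf q z * (pmf s z / pmf q z) \<partial>count_space (set_pmf q)) =
      (\<integral>z. pmf s z \<partial>count_space (set_pmf q))"
    by (rule Bochner_Integration.integral_cong) (simp_all add: set_pmf_iff)
  then show ?B
    by (subst (asm) integral_count_space_pmf) (simp_all add: integral_pmf)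
qed

text \<open>The logarithm is at most log c from above; from below, ln t \<le> t - 1 bounds it by the
  ratio \<open>s / q\<close>, whose expectation under \<open>q\<close> is finite.\<close>

lemma integrable_log_pmf_ratio:
  fixes q s :: "'a pmf"
  assumes le: "\<And>z. z \<in> set_pmf q \<Longrightarrow> pmf q z \<le> c * pmf s z" and c: "1 \<le> c"
  shows "integrable (measure_pmf q) (\<lambda>z. log 2 (pmf q z / pmf s z))"
proof (rule Bochner_Integration.integrable_bound)
  show "integrable (measure_pmf q) (\<lambda>z. log 2 c + (pmf s z / pmf q z) / ln 2)"
    by (intro Bochner_Integration.integrable_add integrable_divide integrable_pmf_ratio) simp
  have "\<bar>log 2 (pmf q z / pmf s z)\<bar> \<le> log 2 c + (pmf s z / pmf q z) / ln 2" if z: "z \<in> set_pmf q" for z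
  proof -
    have q: "pmf q z > 0" using z by (rule pmf_positive)
    have "pmf s z \<noteq> 0" using le[OF z] q by auto
    then have s: "pmf s z > 0" by (simp add: order_less_le)
    have "log 2 (pmf q z / pmf s z) \<le> log 2 c"
      using le[OF z] q s c by (subst log_le_cancel_iff) (auto simp: field_simps)
    moreover have "- log 2 (pmf q z / pmf s z) = ln (pmf s z / pmf q z) / ln 2"
      using q s by (simp add: log_def ln_div field_simps)
    moreover have "ln (pmf s z / pmf q z) / ln 2 \<le> (pmf s z / pmf q z) / ln 2"
      using q s ln_le_minus_one[of "pmf s z / pmf q z"] by (intro divide_right_mono) auto
    moreover have "0 \<le> (pmf s z / pmf q z) / ln 2" "0 \<le> log 2 c"
      using q s c by simp_all
    ultimately show ?thesis by linarith
  qed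
  then show "AE z in measure_pmf q. norm (log 2 (pmf q z / pmf s z)) \<le> norm (log 2 c + (pmf s z / pmf q z) / ln 2)"
    by (force simp: AE_measure_pmf_iff)
qed simp

text \<open>Gibbs' inequality, keeping the defect: the relative entropy is at least the mass that
  \<open>s\<close> puts outside the support of \<open>q\<close>, divided by ln 2.\<close>

lemma set_pmf_subset_if_expectation_log_ratio_eq_0:
  fixes q s :: "'a pmf"
  assumes le: "\<And>z. z \<in> set_pmf q \<Longrightarrow> pmf q z \<le> c * pmf s z" and c: "1 \<le> c"
    and 0: "measure_pmf.expectation q (\<lambda>z. log 2 (pmf q z / pmf s z)) = 0"
  shows "set_pmf s \<subseteq> set_pmf q"
proof -
  have "(1 - measure_pmf.prob s (set_pmf q)) / ln 2 =
      measure_pmf.expectation q (\<lambda>z. (1 - pmf s z / pmf q z) / ln 2)"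
    by (simp add: expectation_pmf_ratio integrable_pmf_ratio)
  also have "\<dots> \<le> measure_pmf.expectation q (\<lambda>z. log 2 (pmf q z / pmf s z))"
  proof (rule integral_mono_AE)
    have "(1 - pmf s z / pmf q z) / ln 2 \<le> log 2 (pmf q z / pmf s z)" if z: "z \<in> set_pmf q" for z
    proof -
      have q: "pmf q z > 0" using z by (rule pmf_positive)
      have "pmf s z \<noteq> 0" using le[OF z] q by auto
      then have s: "pmf s z > 0" by (simp add: order_less_le)
      have "- log 2 (pmf q z / pmf s z) = ln (pmf s z / pmf q z) / ln 2"
        using q s by (simp add: log_def ln_div field_simps)
      also have "\<dots> \<le> (pmf s z / pmf q z - 1) / ln 2"
        using q s ln_le_minus_one[of "pmf s z / pmf q z"] by (intro divide_right_mono) auto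
      finally show ?thesis by (simp add: diff_divide_distrib)
    qed
    then show "AE z in measure_pmf q. (1 - pmf s z / pmf q z) / ln 2 \<le> log 2 (pmf q z / pmf s z)"
      by (simp add: AE_measure_pmf_iff)
  qed (use integrable_log_pmf_ratio[OF le c] in \<open>simp_all add: integrable_pmf_ratio\<close>)
  finally have "measure_pmf.prob s (set_pmf q) = 1"
    using 0 measure_pmf.prob_le_1[of s "set_pmf q"] by (simp add: field_simps)
  then have "AE z in measure_pmf s. z \<in> set_pmf q"
    by (simp add: measure_pmf.prob_eq_1)
  then show ?thesis
    by (auto simp: AE_measure_pmf_iff)
qed

lemma pmf_pair_le_snd: "pmf q (x, y) \<le> pmf (map_pmf snd q) y"
proof -
  have "pmf q (x, y) = measure_pmf.prob q {(x, y)}" by (simp add: measure_pmf_single)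
  also have "\<dots> \<le> measure_pmf.prob q (snd -` {y})"
    by (intro measure_pmf.finite_measure_mono) auto
  finally show ?thesis by (simp add: pmf_map)
qed

text \<open>The integrand is nonnegative, so it vanishes on the support: every pair
  \<open>(x, y)\<close> that occurs carries the whole mass of \<open>y\<close>. Two values of
  \<open>X\<close> over the same \<open>y\<close> would exceed that mass.\<close>

lemma conditional_entropy_bits_eq_0D:
  assumes fin: "finite (X ` set_pmf P)" and 0: "conditional_entropy_bits P X Y = 0"
    and \<omega>: "\<omega> \<in> set_pmf P" "\<omega>' \<in> set_pmf P" "Y \<omega> = Y \<omega>'"
  shows "X \<omega> = X \<omega>'"
proof -
  define q where "q = map_pmf (\<lambda>\<omega>. (X \<omega>, Y \<omega>)) P"
  define B where "B = X ` set_pmf P"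
  \<comment> \<open>The comparison law for integrability: log(q / s) differs from the integrand by
    the constant log(card B).\<close>
  define s where "s = pair_pmf (pmf_of_set B) (map_pmf Y P)"
  have B: "finite B" "B \<noteq> {}" using fin by (auto simp: B_def set_pmf_not_empty)
  then have cB: "1 \<le> real (card B)" by (simp add: Suc_le_eq card_gt_0_iff)
  have Y: "map_pmf Y P = map_pmf snd q" by (simp add: q_def map_pmf_comp)
  have s: "pmf (map_pmf Y P) y = card B * pmf s (x, y)" if "(x, y) \<in> set_pmf q" for x y
    using that B by (auto simp: s_def pmf_pair B_def q_def)
  have "integrable (measure_pmf q) (\<lambda>z. log 2 (pmf q z / pmf s z))"
  proof (rule integrable_log_pmf_ratio[OF _ cB])
    fix z assume "z \<in> set_pmf q"
    then show "pmf q z \<le> card B * pmf s z"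
      using pmf_pair_le_snd[of q "fst z" "snd z"] s[of "fst z" "snd z"] by (simp add: Y)
  qed
  then have "integrable (measure_pmf q) (\<lambda>z. log 2 (pmf q z / pmf s z) - log 2 (card B))"
    by simp
  also have "?this \<longleftrightarrow> integrable (measure_pmf q) (\<lambda>z. log 2 (pmf q z / pmf (map_pmf Y P) (snd z)))"
  proof (rule integrable_cong_AE, simp, simp, unfold AE_measure_pmf_iff, safe)
    fix x y assume z: "(x, y) \<in> set_pmf q"
    then have "(x, y) \<in> set_pmf s" using B by (auto simp: s_def B_def q_def)
    then have "pmf s (x, y) > 0" "pmf q (x, y) > 0"
      using z by (auto intro: pmf_positive)
    then show "log 2 (pmf q (x, y) / pmf s (x, y)) - log 2 (card B) =
        log 2 (pmf q (x, y) / pmf (map_pmf Y P) (snd (x, y)))"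
      using cB by (simp add: s[OF z] log_divide log_mult)
  qed
  finally have int: "integrable (measure_pmf q) (\<lambda>z. - log 2 (pmf q z / pmf (map_pmf Y P) (snd z)))"
    by simp
  have r: "pmf q z > 0" "pmf (map_pmf Y P) (snd z) > 0" "pmf q z / pmf (map_pmf Y P) (snd z) \<le> 1"
    if "z \<in> set_pmf q" for z
    using that pmf_pair_le_snd[of q "fst z" "snd z"]
    by (auto simp: pmf_positive Y intro!: divide_le_eq_1[THEN iffD2])
  have "measure_pmf.expectation q (\<lambda>z. - log 2 (pmf q z / pmf (map_pmf Y P) (snd z))) = 0"
    using 0 by (simp add: conditional_entropy_bits_eq q_def)
  moreover have "AE z in measure_pmf q. 0 \<le> - log 2 (pmf q z / pmf (map_pmf Y P) (snd z))"
    using r by (auto simp: AE_measure_pmf_iff)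
  ultimately have "AE z in measure_pmf q. - log 2 (pmf q z / pmf (map_pmf Y P) (snd z)) = 0"
    using integral_nonneg_eq_0_iff_AE[OF int] by simp
  then have eq: "pmf q z = pmf (map_pmf Y P) (snd z)" if "z \<in> set_pmf q" for z
    using that r[OF that] by (auto simp: AE_measure_pmf_iff log_eq_one log_def)
  show ?thesis
  proof (rule ccontr)
    assume neq: "X \<omega> \<noteq> X \<omega>'"
    let ?y = "Y \<omega>"
    have in_q: "(X \<omega>, ?y) \<in> set_pmf q" "(X \<omega>', ?y) \<in> set_pmf q"
      using \<omega> by (auto simp: q_def)
    have "pmf q (X \<omega>, ?y) + pmf q (X \<omega>', ?y) = measure_pmf.prob q {(X \<omega>, ?y), (X \<omega>', ?y)}"
      using neq by (subst measure_measure_pmf_finite) auto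
    also have "\<dots> \<le> measure_pmf.prob q (snd -` {?y})"
      by (intro measure_pmf.finite_measure_mono) auto
    also have "\<dots> = pmf (map_pmf Y P) ?y" by (simp add: Y pmf_map)
    finally show False
      using eq[OF in_q(1)] r(1)[OF in_q(2)] by simp
  qed
qed

lemma conditional_entropy_bits_eq_0I:
  assumes det: "\<And>\<omega> \<omega>'. \<omega> \<in> set_pmf P \<Longrightarrow> \<omega>' \<in> set_pmf P \<Longrightarrow> Y \<omega> = Y \<omega>' \<Longrightarrow> X \<omega> = X \<omega>'"
  shows "conditional_entropy_bits P X Y = 0"
proof -
  define g where "g y = X (SOME \<omega>. \<omega> \<in> set_pmf P \<and> Y \<omega> = y)" for y
  have g: "X \<omega> = g (Y \<omega>)" if "\<omega> \<in> set_pmf P" for \<omega>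
    unfolding g_def by (rule someI2[where a = \<omega>]) (use that in \<open>auto intro: det\<close>)
  have XY: "map_pmf (\<lambda>\<omega>. (X \<omega>, Y \<omega>)) P = map_pmf (\<lambda>y. (g y, y)) (map_pmf Y P)"
    unfolding map_pmf_comp using g by (intro map_pmf_cong) auto
  have p: "pmf (map_pmf (\<lambda>y. (g y, y)) q) (g y, y) = pmf q y" for q y
    by (rule pmf_map_inj') (auto simp: inj_on_def)
  show ?thesis
    unfolding conditional_entropy_bits_eq XY
    by (auto simp: g p AE_measure_pmf_iff pmf_eq_0_set_pmf intro!: integral_eq_zero_AE)
qed

text \<open>Mutual information is the relative entropy of the joint law to the product law; when it
  is 0, the joint support is the full product of the supports.\<close>

lemma set_pmf_pair_if_conditional_mutual_information_bits_eq_0: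
  assumes Z: "\<And>\<omega>. \<omega> \<in> set_pmf P \<Longrightarrow> Z \<omega> = c"
    and fin: "finite (X ` set_pmf P)" and 0: "conditional_mutual_information_bits P X Y Z = 0"
    and \<omega>: "\<omega> \<in> set_pmf P" "\<omega>' \<in> set_pmf P"
  shows "\<exists>\<omega>''\<in>set_pmf P. X \<omega>'' = X \<omega> \<and> Y \<omega>'' = Y \<omega>'"
proof -
  define q where "q = map_pmf (\<lambda>\<omega>. (X \<omega>, Y \<omega>)) P"
  define s where "s = pair_pmf (map_pmf X P) (map_pmf Y P)"
  define B where "B = X ` set_pmf P"
  have B: "finite B" "B \<noteq> {}" using fin by (auto simp: B_def set_pmf_not_empty)
  \<comment> \<open>The range of \<open>X\<close> is finite, so the sum bounds every single
    \<open>1 / pmf\<close>; the leading 1 secures \<open>1 \<le> C\<close>.\<close>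
  define C where "C = 1 + (\<Sum>x\<in>B. 1 / pmf (map_pmf X P) x)"
  have C: "1 / pmf (map_pmf X P) x \<le> C" if "x \<in> B" for x
    unfolding C_def using B that by (intro add_increasing member_le_sum) auto
  have Y: "map_pmf Y P = map_pmf snd q" by (simp add: q_def map_pmf_comp)
  have "set_pmf s \<subseteq> set_pmf q"
  proof (rule set_pmf_subset_if_expectation_log_ratio_eq_0)
    show "1 \<le> C" unfolding C_def by (simp add: sum_nonneg)
    show "pmf q z \<le> C * pmf s z" if "z \<in> set_pmf q" for z
    proof -
      obtain x y where z: "z = (x, y)" by (cases z)
      have x: "x \<in> B" using that z by (auto simp: q_def B_def)
      then have px: "pmf (map_pmf X P) x > 0" by (auto simp: B_def intro!: pmf_positive)
      have "1 \<le> C * pmf (map_pmf X P) x" using C[OF x] px by (simp add: field_simps)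
      then have "pmf (map_pmf Y P) y * 1 \<le> pmf (map_pmf Y P) y * (C * pmf (map_pmf X P) x)"
        by (intro mult_left_mono) auto
      then show ?thesis
        using pmf_pair_le_snd[of q x y] by (simp add: z s_def pmf_pair Y mult_ac)
    qed
    show "measure_pmf.expectation q (\<lambda>z. log 2 (pmf q z / pmf s z)) = 0"
      using 0 by (simp add: conditional_mutual_information_bits_const[OF Z] q_def s_def pmf_pair)
  qed
  then have "(X \<omega>, Y \<omega>') \<in> set_pmf q"
    using \<omega> by (auto simp: s_def)
  then show ?thesis by (auto simp: q_def)
qed

lemma conditional_mutual_information_bits_eq_0I:
  assumes Z: "\<And>\<omega>. \<omega> \<in> set_pmf P \<Longrightarrow> Z \<omega> = c"
    and XY: "map_pmf (\<lambda>\<omega>. (X \<omega>, Y \<omega>)) P = pair_pmf q r"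
  shows "conditional_mutual_information_bits P X Y Z = 0"
proof -
  have "map_pmf X P = map_pmf fst (map_pmf (\<lambda>\<omega>. (X \<omega>, Y \<omega>)) P)"
    and "map_pmf Y P = map_pmf snd (map_pmf (\<lambda>\<omega>. (X \<omega>, Y \<omega>)) P)"
    by (simp_all add: map_pmf_comp)
  then have "map_pmf X P = q" "map_pmf Y P = r"
    by (simp_all add: XY map_fst_pair_pmf map_snd_pair_pmf)
  then show ?thesis
    using set_map_pmf[of "\<lambda>\<omega>. (X \<omega>, Y \<omega>)" P] XY
    by (subst conditional_mutual_information_bits_const[where c = c])
      (auto simp: Z pmf_pair AE_measure_pmf_iff pmf_eq_0_set_pmf intro!: integral_eq_zero_AE)
qed

section \<open>Bounds on the Shannon entropy\<close>

lemma finite_entropy_range_space_iff: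
  "information_space.finite_entropy (supp_space P) 2 (range_space P X) X (pmf (map_pmf X P)) \<longleftrightarrow>
     integrable (measure_pmf P) (\<lambda>\<omega>. log 2 (pmf (map_pmf X P) (X \<omega>)))"
proof -
  interpret information_space "supp_space P" 2 by (rule information_space_supp_space)
  have "integrable (range_space P X) (\<lambda>x. pmf (map_pmf X P) x * log 2 (pmf (map_pmf X P) x)) \<longleftrightarrow>
      integrable (measure_pmf (map_pmf X P)) (\<lambda>x. log 2 (pmf (map_pmf X P) x))"
    unfolding range_space_def by (rule integrable_count_space_pmf) auto
  then show ?thesis
    using distributed_supp_space[of P X] by (simp add: finite_entropy_def)
qed

lemma entropy_range_space:
  "prob_space.entropy (supp_space P) 2 (range_space P X) X =
     - measure_pmf.expectation P (\<lambda>\<omega>. log 2 (pmf (map_pmf X P) (X \<omega>)))"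
proof -
  interpret information_space "supp_space P" 2 by (rule information_space_supp_space)
  have "(\<integral>x. pmf (map_pmf X P) x * log 2 (pmf (map_pmf X P) x) \<partial>range_space P X) =
      measure_pmf.expectation (map_pmf X P) (\<lambda>x. log 2 (pmf (map_pmf X P) x))"
    unfolding range_space_def by (rule integral_count_space_pmf) auto
  then show ?thesis
    by (subst entropy_distr[OF distributed_supp_space]) simp_all
qed

text \<open>Shannon entropy dominates min-entropy. If the integral diverges, the entropy is infinite
  by definition and the bound is immediate.\<close>

lemma log_le_entropy_bits:
  assumes "0 < c" "\<And>a. pmf (map_pmf X P) a \<le> 1 / c"
  shows "ereal (log 2 c) \<le> entropy_bits P X"
proof (cases "integrable (measure_pmf P) (\<lambda>\<omega>. log 2 (pmf (map_pmf X P) (X \<omega>)))")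
  case True
  have "measure_pmf.expectation P (\<lambda>\<omega>. log 2 (pmf (map_pmf X P) (X \<omega>))) \<le>
      measure_pmf.expectation P (\<lambda>\<omega>. - log 2 c)"
  proof (rule integral_mono_AE[OF True])
    have "log 2 (pmf (map_pmf X P) (X \<omega>)) \<le> log 2 (1 / c)" if "\<omega> \<in> set_pmf P" for \<omega>
      using that assms(1) assms(2)[of "X \<omega>"]
      by (subst log_le_cancel_iff) (auto simp: pmf_positive)
    then show "AE \<omega> in measure_pmf P. log 2 (pmf (map_pmf X P) (X \<omega>)) \<le> - log 2 c"
      using assms(1) by (simp add: AE_measure_pmf_iff log_divide)
  qed simp
  then show ?thesis
    using True by (simp add: entropy_bits_def finite_entropy_range_space_iff entropy_range_space)
qed (simp add: entropy_bits_def finite_entropy_range_space_iff)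

lemma entropy_bits_le_log_card:
  assumes "finite B" "X ` set_pmf P \<subseteq> B"
  shows "entropy_bits P X \<le> ereal (log 2 (card B))"
proof -
  interpret information_space "supp_space P" 2 by (rule information_space_supp_space)
  have fin: "finite (X ` set_pmf P)" using assms finite_subset by blast
  have "integrable (measure_pmf (map_pmf X P)) (\<lambda>x. log 2 (pmf (map_pmf X P) x))"
    using fin by (intro integrable_measure_pmf_finite) simp
  then have F: "finite_entropy (range_space P X) X (pmf (map_pmf X P))"
    by (simp add: finite_entropy_range_space_iff)
  have "entropy 2 (range_space P X) X \<le> log 2 (measure (range_space P X) (space (range_space P X)))"
    using F fin unfolding finite_entropy_def
    by (intro entropy_le_space[OF distributed_supp_space])
      (auto simp: range_space_def finite_measure_count_space)
  also have "\<dots> = log 2 (card (X ` set_pmf P))"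
    using fin by (simp add: range_space_def measure_count_space)
  also have "\<dots> \<le> log 2 (card B)"
    using fin assms
    by (subst log_le_cancel_iff) (auto simp: card_gt_0_iff set_pmf_not_empty card_mono)
  finally show ?thesis
    using F by (simp add: entropy_bits_def)
qed

section \<open>The lower bound on the answer entropy\<close>

lemma cond_pmf_superset:
  assumes "set_pmf P \<subseteq> E"
  shows "cond_pmf P E = P"
proof (rule pmf_eqI)
  fix x
  have ne: "set_pmf P \<inter> E \<noteq> {}" using assms set_pmf_not_empty[of P] by blast
  have "measure_pmf.prob P E = 1"
    using assms by (auto simp: measure_pmf.prob_eq_1 AE_measure_pmf_iff)
  then show "pmf (cond_pmf P E) x = pmf P x"
    using assms by (auto simp: pmf_cond[OF ne] pmf_eq_0_set_pmf)
qed

text \<open>Inverts the ranking by which \<open>side_info\<close> attaches coefficients to indices,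
  so that the side information becomes a sum over \<open>S\<close> itself.\<close>

definition coefficient_at :: "nat set \<Rightarrow> int list \<Rightarrow> nat \<Rightarrow> int" where
  "coefficient_at S C i = C ! the_inv_into {..<card S} ((!) (sorted_list_of_set S)) i"

lemma bij_betw_nth_sorted_list_of_set:
  "finite S \<Longrightarrow> bij_betw ((!) (sorted_list_of_set S)) {..<card S} S"
  by (rule bij_betw_nth) (simp_all add: distinct_sorted_list_of_set)

lemma coefficient_at_map:
  assumes "finite S" "i \<in> S"
  shows "coefficient_at S (map h (sorted_list_of_set S)) i = h i"
proof -
  note b = bij_betw_nth_sorted_list_of_set[OF assms(1)]
  obtain j where j: "j < card S" "i = sorted_list_of_set S ! j"
    using b assms(2) by (auto simp: bij_betw_def)
  then show ?thesis
    using the_inv_into_f_f[OF bij_betw_imp_inj_on[OF b], of j] by (simp add: coefficient_at_def)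
qed

section \<open>Model II for fixed parameters and the consequences of recoverability and
  privacy\<close>

locale pcsi_setting =
  fixes K M q l :: nat and R :: "int ring" (structure) and F :: "int set"
  assumes M: "2 \<le> M" "M \<le> K" and fp: "field_pair q l R F"

sublocale pcsi_setting \<subseteq> field R
  using fp by (simp add: field_pair_def)

context pcsi_setting
begin

definition messages :: "(nat \<Rightarrow> int) set" where
  "messages = PiE_dflt {1..K} undefined (\<lambda>_. carrier R)"

lemma field_pair_facts: "2 \<le> q" "1 \<le> l" "card F = q" "card (carrier R) = q ^ l" "subfield F R"
  using fp primepow_gt_Suc_0[of q] by (auto simp: field_pair_def)

lemma F_subset: "F \<subseteq> carrier R"
  using field_pair_facts(5) by (rule subfieldE(3))

lemma finite_carrier [simp]: "finite (carrier R)"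
  using field_pair_facts by (intro card_ge_0_finite) auto

lemma finite_F [simp]: "finite F"
  using F_subset finite_carrier by (rule finite_subset)

lemma card_carrier_gt_1: "1 < card (carrier R)"
  using one_less_power[of q l] field_pair_facts by simp

lemma finite_supports [simp]: "finite (supports K M)"
  by (rule finite_subset[of _ "Pow {1..K}"]) (auto simp: supports_def)

lemma supports_nonempty [simp]: "supports K M \<noteq> {}"
proof -
  have "{1..M} \<in> supports K M" using M by (auto simp: supports_def)
  then show ?thesis by blast
qed

lemma supportsD:
  assumes "S \<in> supports K M"
  shows "finite S" "S \<noteq> {}" "S \<subseteq> {1..K}" "card S = M"
  using assms M by (auto simp: supports_def intro: finite_subset)

lemma finite_coefficient_seqs [simp]: "finite (coefficient_seqs M R F)"
  using finite_lists_length_eq[of "F - {\<zero>}" M] by (simp add: coefficient_seqs_def conj_commute)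

lemma coefficient_seqs_nonempty [simp]: "coefficient_seqs M R F \<noteq> {}"
proof -
  have "\<not> F \<subseteq> {\<zero>}" using field_pair_facts card_mono[of "{\<zero>}" F] by auto
  then obtain c where "c \<in> F" "c \<noteq> \<zero>" by blast
  then have "replicate M c \<in> coefficient_seqs M R F" by (auto simp: coefficient_seqs_def)
  then show ?thesis by blast
qed

lemma finite_messages [simp]: "finite messages"
  unfolding messages_def by (rule finite_PiE_dflt) auto

lemma messages_nonempty [simp]: "messages \<noteq> {}"
  by (auto simp: messages_def PiE_dflt_empty_iff)

lemma card_messages: "card messages = card (carrier R) ^ K"
  unfolding messages_def by (subst card_PiE_dflt) auto

lemma messages_pmf: "Pi_pmf {1..K} undefined (\<lambda>_. pmf_of_set (carrier R)) = pmf_of_set messages"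
  unfolding messages_def by (rule Pi_pmf_of_set) auto

lemma messages_carrier: "x \<in> messages \<Longrightarrow> i \<in> {1..K} \<Longrightarrow> x i \<in> carrier R"
  by (auto simp: messages_def PiE_dflt_def)

lemma messages_eqI:
  assumes "x \<in> messages" "x' \<in> messages" and eq: "\<And>i. i \<in> {1..K} \<Longrightarrow> x i = x' i"
  shows "x = x'"
proof
  show "x i = x' i" for i
    using assms(1,2) eq[of i] by (cases "i \<in> {1..K}") (auto simp: messages_def PiE_dflt_def)
qed

lemma set_pmf_model_II:
  "\<omega> \<in> set_pmf (model_II K M R F query) \<longleftrightarrow>
     rv_S \<omega> \<in> supports K M \<and> rv_W \<omega> \<in> rv_S \<omega> \<and> rv_C \<omega> \<in> coefficient_seqs M R F \<and>
     rv_Q \<omega> \<in> set_pmf (query (rv_W \<omega>) (rv_S \<omega>) (rv_C \<omega>)) \<and> rv_X \<omega> \<in> messages"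
proof -
  have [simp]: "set_pmf (pmf_of_set S) = S" if "S \<in> supports K M" for S
    using supportsD[OF that] by (intro set_pmf_of_set)
  then have "set_pmf (model_II K M R F query) =
     {\<lparr>rv_W = W, rv_S = S, rv_C = C, rv_Q = Q, rv_X = X\<rparr> | W S C Q X.
       S \<in> supports K M \<and> W \<in> S \<and> C \<in> coefficient_seqs M R F \<and> Q \<in> set_pmf (query W S C) \<and> X \<in> messages}"
    unfolding model_II_def messages_pmf by (fastforce simp: set_bind_pmf)
  then show ?thesis
    by (cases \<omega>) auto
qed

text \<open>Messages are independent of the query, so the answer law is a mixture over queries; a
  bound on the probabilities that holds for every query passes to the mixture.\<close>

lemma map_rv_A_model_II:
  "map_pmf (rv_A answer) (model_II K M R F query) =
     bind_pmf (map_pmf rv_Q (model_II K M R F query)) (\<lambda>Q. map_pmf (answer Q True) (pmf_of_set messages))"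
proof -
  have "map_pmf (rv_A answer) (model_II K M R F query) =
      map_pmf (\<lambda>\<omega>. answer (rv_Q \<omega>) True (rv_X \<omega>)) (model_II K M R F query)"
    by (rule map_pmf_cong) (auto simp: rv_A_def set_pmf_model_II)
  also have "\<dots> = bind_pmf (map_pmf rv_Q (model_II K M R F query))
      (\<lambda>Q. map_pmf (answer Q True) (pmf_of_set messages))"
    unfolding model_II_def messages_pmf
    by (simp add: map_bind_pmf bind_assoc_pmf bind_return_pmf bind_map_pmf map_pmf_def[of "answer _ _"])
  finally show ?thesis .
qed

lemma recoverabilityD:
  assumes "recoverability K M R F query answer"
    and "S \<in> supports K M" "W \<in> S" "C \<in> coefficient_seqs M R F" "Q \<in> set_pmf (query W S C)"
    and "x \<in> messages" "x' \<in> messages"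
    and "answer Q True x = answer Q True x'" "side_info R S C x = side_info R S C x'"
  shows "x W = x' W"
proof -
  let ?\<omega> = "\<lambda>x. \<lparr>rv_W = W, rv_S = S, rv_C = C, rv_Q = Q, rv_X = x\<rparr>"
  have "rv_X (?\<omega> x) (rv_W (?\<omega> x)) = rv_X (?\<omega> x') (rv_W (?\<omega> x'))"
  proof (rule conditional_entropy_bits_eq_0D[OF _ assms(1)[unfolded recoverability_def]])
    show "finite ((\<lambda>\<omega>. rv_X \<omega> (rv_W \<omega>)) ` set_pmf (model_II K M R F query))"
      by (rule finite_subset[OF _ finite_carrier])
        (use supportsD(3) in \<open>fastforce simp: set_pmf_model_II intro!: messages_carrier\<close>)
  qed (use assms in \<open>auto simp: set_pmf_model_II rv_A_def rv_Y_def\<close>)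
  then show ?thesis by simp
qed

text \<open>Only the joint support of \<open>(W, S)\<close> and \<open>Q\<close> is controlled,
  hence the coefficients are existential and may depend on all three.\<close>

lemma WS_privacyD:
  assumes "WS_privacy K M R F query"
    and "Q \<in> rv_Q ` set_pmf (model_II K M R F query)" and "S \<in> supports K M" "W \<in> S"
  shows "\<exists>C\<in>coefficient_seqs M R F. Q \<in> set_pmf (query W S C)"
proof -
  obtain \<omega>' where \<omega>': "\<omega>' \<in> set_pmf (model_II K M R F query)" "Q = rv_Q \<omega>'"
    using assms(2) by blast
  obtain C where C: "C \<in> coefficient_seqs M R F" using coefficient_seqs_nonempty by blast
  obtain Q' where Q': "Q' \<in> set_pmf (query W S C)" using set_pmf_not_empty by fast
  \<comment> \<open>Any outcome with demand \<open>W\<close> and support \<open>S\<close> will do;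
    the product form of the support then exchanges its query \<open>Q'\<close> for
    \<open>Q\<close>.\<close>
  define \<omega> where "\<omega> = \<lparr>rv_W = W, rv_S = S, rv_C = C, rv_Q = Q', rv_X = rv_X \<omega>'\<rparr>"
  have "\<omega> \<in> set_pmf (model_II K M R F query)"
    using \<omega>' C Q' assms by (simp add: set_pmf_model_II \<omega>_def)
  have "\<exists>\<omega>''\<in>set_pmf (model_II K M R F query). (rv_W \<omega>'', rv_S \<omega>'') = (rv_W \<omega>, rv_S \<omega>) \<and> rv_Q \<omega>'' = rv_Q \<omega>'"
  proof (rule set_pmf_pair_if_conditional_mutual_information_bits_eq_0[OF _ _ assms(1)[unfolded WS_privacy_def]])
    have "(\<lambda>\<omega>. (rv_W \<omega>, rv_S \<omega>)) ` set_pmf (model_II K M R F query) \<subseteq> {1..K} \<times> supports K M"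
      using supportsD(3) by (fastforce simp: set_pmf_model_II)
    then show "finite ((\<lambda>\<omega>. (rv_W \<omega>, rv_S \<omega>)) ` set_pmf (model_II K M R F query))"
      by (rule finite_subset) auto
  qed (use \<omega>' \<open>\<omega> \<in> _\<close> in \<open>auto simp: set_pmf_model_II\<close>)
  then show ?thesis
    using \<omega>' by (auto simp: \<omega>_def set_pmf_model_II)
qed

lemma pir_pcsi_II_decodable:
  assumes "pir_pcsi_II K M R F query answer"
    and "Q \<in> rv_Q ` set_pmf (model_II K M R F query)" and "S \<in> supports K M" "W \<in> S"
  shows "\<exists>C\<in>coefficient_seqs M R F. \<forall>x\<in>messages. \<forall>x'\<in>messages.
    answer Q True x = answer Q True x' \<longrightarrow> side_info R S C x = side_info R S C x' \<longrightarrow> x W = x' W"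
  using WS_privacyD[OF _ assms(2-4)] recoverabilityD[OF _ assms(3,4)] assms(1)
  unfolding pir_pcsi_II_def by metis

lemma entropy_given_event_model_II:
  "entropy_given_event (model_II K M R F query) X {\<omega>. rv_ind \<omega>} = entropy_bits (model_II K M R F query) X"
  unfolding entropy_given_event_def by (subst cond_pmf_superset) (auto simp: set_pmf_model_II)

text \<open>
  The min-entropy of the answer is bounded instead of its Shannon entropy, so that no conditioning
  on the query is needed.
\<close>

lemma rate_le_if_card_fibre_le:
  assumes fibre: "\<And>Q a. Q \<in> rv_Q ` set_pmf (model_II K M R F query) \<Longrightarrow>
      card {x \<in> messages. answer Q True x = a} \<le> card (carrier R) ^ (M - 1)"
  shows "rate K M q l R F query answer \<le> ereal (inverse (real K - real M + 1))"
proof -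
  define n where "n = real (card (carrier R))"
  define N where "N = K + 1 - M"
  define L where "L = real l * log 2 (real q)"
  have n: "n > 1" using card_carrier_gt_1 by (simp add: n_def)
  have N: "N > 0" "real N = real K - real M + 1" "K = N + (M - 1)" using M by (auto simp: N_def of_nat_diff)
  have L: "L > 0" "log 2 n = L" using field_pair_facts by (auto simp: L_def n_def log_nat_power)
  have "pmf (map_pmf (rv_A answer) (model_II K M R F query)) a \<le> 1 / n ^ N" for a
  proof -
    have "pmf (map_pmf (answer Q True) (pmf_of_set messages)) a \<le> 1 / n ^ N"
      if "Q \<in> rv_Q ` set_pmf (model_II K M R F query)" for Q
    proof -
      have "pmf (map_pmf (answer Q True) (pmf_of_set messages)) a =
          card {x \<in> messages. answer Q True x = a} / n ^ K"
        by (simp add: pmf_map measure_pmf_of_set card_messages n_def vimage_def Int_def del: One_nat_def)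
      also have "\<dots> \<le> n ^ (M - 1) / n ^ K"
        using fibre[OF that, of a] n by (intro divide_right_mono) (auto simp: n_def simp flip: of_nat_power)
      also have "\<dots> = 1 / n ^ N"
        using n by (subst N(3)) (simp add: power_add)
      finally show ?thesis .
    qed
    then show ?thesis
      unfolding map_rv_A_model_II pmf_bind
      by (intro measure_pmf.integral_le_const measure_pmf.integrable_const_bound[where B = 1])
        (auto simp: AE_measure_pmf_iff pmf_le_1)
  qed
  then have "ereal (log 2 (n ^ N)) \<le> entropy_bits (model_II K M R F query) (rv_A answer)"
    using n by (intro log_le_entropy_bits) auto
  then have H: "ereal (N * L) \<le> entropy_bits (model_II K M R F query) (rv_A answer)"
    using n L by (simp add: log_nat_power)
  show ?thesis
  proof (cases "entropy_bits (model_II K M R F query) (rv_A answer)")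
    case (real h)
    then have h: "N * L \<le> h" using H by simp
    moreover have "0 < N * L" using N(1) L(1) by simp
    ultimately have "0 < h" by linarith
    then have "L / h \<le> inverse N"
      using h L(1) N(1) by (simp add: field_simps)
    then show ?thesis
      using real \<open>0 < h\<close> by (simp add: rate_def entropy_given_event_model_II L_def flip: N(2))
  next
    case PInf
    then show ?thesis
      by (simp add: rate_def entropy_given_event_model_II flip: N(2))
  qed (use H in auto)
qed

section \<open>Side information as a weighted sum over the support\<close>

lemma coefficient_at_in:
  assumes "S \<in> supports K M" "C \<in> coefficient_seqs M R F" "i \<in> S"
  shows "coefficient_at S C i \<in> F - {\<zero>}"
proof -
  note b = bij_betw_nth_sorted_list_of_set[OF supportsD(1)[OF assms(1)]]
  have "the_inv_into {..<card S} ((!) (sorted_list_of_set S)) i < length C"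
    using bij_betw_the_inv_into[OF b] assms supportsD(4)[OF assms(1)]
    by (auto simp: bij_betw_def coefficient_seqs_def)
  then have "coefficient_at S C i \<in> set C"
    unfolding coefficient_at_def by (rule nth_mem)
  then show ?thesis
    using assms(2) by (auto simp: coefficient_seqs_def)
qed

lemma coefficient_at_carrier [simp]:
  "S \<in> supports K M \<Longrightarrow> C \<in> coefficient_seqs M R F \<Longrightarrow> i \<in> S \<Longrightarrow> coefficient_at S C i \<in> carrier R"
  using coefficient_at_in F_subset by blast

lemma side_info_eq:
  assumes S: "S \<in> supports K M" and C: "C \<in> coefficient_seqs M R F" and x: "x \<in> messages"
  shows "side_info R S C x = (\<Oplus>i\<in>S. coefficient_at S C i \<otimes> x i)"
proof -
  let ?h = "(!) (sorted_list_of_set S)"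
  note b = bij_betw_nth_sorted_list_of_set[OF supportsD(1)[OF S]]
  have im: "?h ` {..<card S} = S" and inj: "inj_on ?h {..<card S}"
    using b by (auto simp: bij_betw_def)
  have car: "(\<lambda>i. coefficient_at S C i \<otimes> x i) \<in> S \<rightarrow> carrier R"
    using S C supportsD(3)[OF S] messages_carrier[OF x] by auto
  have "(\<Oplus>i\<in>S. coefficient_at S C i \<otimes> x i) = (\<Oplus>i\<in>?h ` {..<card S}. coefficient_at S C i \<otimes> x i)"
    by (simp only: im)
  also have "\<dots> = (\<Oplus>j\<in>{..<card S}. coefficient_at S C (?h j) \<otimes> x (?h j))"
    by (rule add.finprod_reindex) (use im inj car in auto)
  also have "\<dots> = side_info R S C x"
    unfolding side_info_def
  proof (rule add.finprod_cong')
    show "(\<lambda>j. C ! j \<otimes> x (?h j)) \<in> {..<card S} \<rightarrow> carrier R"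
    proof
      fix j assume j: "j \<in> {..<card S}"
      then have "C ! j \<in> set C" "?h j \<in> S"
        using C supportsD(4)[OF S] im by (auto simp: coefficient_seqs_def)
      then show "C ! j \<otimes> x (?h j) \<in> carrier R"
        using C F_subset supportsD(3)[OF S]
        by (intro m_closed messages_carrier[OF x]) (auto simp: coefficient_seqs_def)
    qed
    show "coefficient_at S C (?h j) \<otimes> x (?h j) = C ! j \<otimes> x (?h j)" if "j \<in> {..<card S}" for j
      using that the_inv_into_f_f[OF inj] by (simp add: coefficient_at_def)
  qed simp
  finally show ?thesis by simp
qed

lemma side_info_carrier:
  assumes "S \<in> supports K M" "C \<in> coefficient_seqs M R F" "x \<in> messages"
  shows "side_info R S C x \<in> carrier R"
  unfolding side_info_eq[OF assms]
  using assms supportsD(3)[OF assms(1)] messages_carrier[OF assms(3)]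
  by (intro finsum_closed) auto

lemma messages_carrier_support:
  "x \<in> messages \<Longrightarrow> S \<in> supports K M \<Longrightarrow> i \<in> S \<Longrightarrow> x i \<in> carrier R"
  using supportsD(3) by (blast intro: messages_carrier)

lemma side_info_cancel:
  assumes S: "S \<in> supports K M" and C: "C \<in> coefficient_seqs M R F"
    and x: "x \<in> messages" "x' \<in> messages"
    and eq: "side_info R S C x = side_info R S C x'"
    and j: "j \<in> S" and other: "\<And>i. i \<in> S \<Longrightarrow> i \<noteq> j \<Longrightarrow> x i = x' i"
  shows "x j = x' j"
proof -
  let ?c = "coefficient_at S C"
  have [simp]: "x i \<in> carrier R" "x' i \<in> carrier R" "?c i \<in> carrier R" if "i \<in> S" for i
    using that S C x by (simp_all add: messages_carrier_support)
  have sum: "side_info R S C y = ?c j \<otimes> y j \<oplus> (\<Oplus>i\<in>S - {j}. ?c i \<otimes> y i)"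
    if "y \<in> messages" "\<And>i. i \<in> S \<Longrightarrow> y i \<in> carrier R" for y
  proof -
    have "(\<Oplus>i\<in>insert j (S - {j}). ?c i \<otimes> y i) = ?c j \<otimes> y j \<oplus> (\<Oplus>i\<in>S - {j}. ?c i \<otimes> y i)"
      using that(2) supportsD(1)[OF S] j by (intro finsum_insert) auto
    then show ?thesis
      using j side_info_eq[OF S C that(1)] by (simp only: insert_Diff)
  qed
  have "(\<Oplus>i\<in>S - {j}. ?c i \<otimes> x i) = (\<Oplus>i\<in>S - {j}. ?c i \<otimes> x' i)"
    by (rule finsum_cong') (auto simp: other)
  moreover have "(\<Oplus>i\<in>S - {j}. ?c i \<otimes> x' i) \<in> carrier R"
    by (rule finsum_closed) auto
  ultimately have "?c j \<otimes> x j = ?c j \<otimes> x' j"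
    using eq j by (simp add: sum x)
  moreover have "?c j \<noteq> \<zero>" using coefficient_at_in[OF S C j] by simp
  ultimately show ?thesis using j by (simp add: m_lcancel)
qed

text \<open>What recoverability and privacy leave for one fixed query. The order of the quantifiers
  lets \<open>C\<close> depend on \<open>W\<close>, not only on \<open>S\<close>.\<close>

definition decodable :: "((nat \<Rightarrow> int) \<Rightarrow> int list) \<Rightarrow> bool" where
  "decodable g \<longleftrightarrow> (\<forall>S\<in>supports K M. \<forall>W\<in>S. \<exists>C\<in>coefficient_seqs M R F. \<forall>x\<in>messages. \<forall>x'\<in>messages.
    g x = g x' \<longrightarrow> side_info R S C x = side_info R S C x' \<longrightarrow> x W = x' W)"

lemma decodable_answer:
  assumes "pir_pcsi_II K M R F query answer" and "Q \<in> rv_Q ` set_pmf (model_II K M R F query)"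
  shows "decodable (answer Q True)"
  unfolding decodable_def using pir_pcsi_II_decodable[OF assms] by blast

text \<open>
  With \<open>N = K - M + 1\<close>, choose supports \<open>S i\<close> containing \<open>1, \<dots>, i\<close> and \<open>N + i, \<dots>, K\<close>: the answer
  together with the side informations \<open>Y i\<close> reveals the first \<open>N\<close> messages, after which the \<open>Y i\<close>
  form a triangular system in the messages \<open>N + i\<close>. So the \<open>N\<close> values \<open>Y i\<close> and the
  \<open>K - 2 * N\<close> remaining messages determine a point of a fibre.
\<close>

lemma card_fibre_le_if_decodable:
  assumes g: "decodable g" and KM: "K + 2 \<le> 2 * M"
  shows "card {x \<in> messages. g x = a} \<le> card (carrier R) ^ (M - 1)"
proof -
  define N where "N = K + 1 - M"
  have N: "1 \<le> N" "N \<le> M - 1" "N + (M - 1) = K" using M KM by (auto simp: N_def)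
  \<comment> \<open>The upper block has \<open>K + 1 - (N + i) = M - i\<close> elements, so the size
    is \<open>M\<close>. It contains \<open>N + i\<close> because
    \<open>i \<le> N \<le> M - 1\<close>, and here the hypothesis on \<open>K\<close> and
    \<open>M\<close> enters.\<close>
  define S where "S i = {1..i} \<union> {N + i..K}" for i
  have S: "S i \<in> supports K M" "i \<in> S i" "N + i \<in> S i" if "i \<in> {1..N}" for i
  proof -
    have "card (S i) = i + (K + 1 - (N + i))"
      unfolding S_def using that by (subst card_Un_disjoint) auto
    then show "S i \<in> supports K M" "i \<in> S i" "N + i \<in> S i"
      using that N M by (auto simp: supports_def S_def)
  qed
  define dec where "dec i C \<longleftrightarrow> C \<in> coefficient_seqs M R F \<and> (\<forall>x\<in>messages. \<forall>x'\<in>messages.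
    g x = g x' \<longrightarrow> side_info R (S i) C x = side_info R (S i) C x' \<longrightarrow> x i = x' i)" for i C
  have "\<exists>C. dec i C" if "i \<in> {1..N}" for i
    using g[unfolded decodable_def, rule_format, OF S(1,2)[OF that]] unfolding dec_def by blast
  then obtain C where dec: "\<And>i. i \<in> {1..N} \<Longrightarrow> dec i (C i)"
    by metis
  then have C: "C i \<in> coefficient_seqs M R F" if "i \<in> {1..N}" for i
    using that by (simp add: dec_def)
  \<comment> \<open>Coordinate \<open>j\<close> stands for the message \<open>N + j\<close>, which
    the side information of \<open>S j\<close> replaces when \<open>j \<le> N\<close>. The first
    \<open>N\<close> messages need no coordinate, as they get decoded.\<close>
  define \<phi> where "\<phi> x = (\<lambda>j\<in>{1..M - 1}. if j \<le> N then side_info R (S j) (C j) x else x (N + j))" for x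
  have "\<phi> ` {x \<in> messages. g x = a} \<subseteq> {1..M - 1} \<rightarrow>\<^sub>E carrier R"
  proof (rule image_subsetI)
    fix x assume "x \<in> {x \<in> messages. g x = a}"
    then have x: "x \<in> messages" by simp
    have "x (N + j) \<in> carrier R" if "j \<in> {1..M - 1}" for j
      using that N by (intro messages_carrier[OF x]) auto
    then show "\<phi> x \<in> {1..M - 1} \<rightarrow>\<^sub>E carrier R"
      unfolding \<phi>_def restrict_PiE_iff using side_info_carrier[OF S(1) C x] by simp
  qed
  moreover have "inj_on \<phi> {x \<in> messages. g x = a}"
  proof (rule inj_onI)
    fix x x' assume "x \<in> {x \<in> messages. g x = a}" "x' \<in> {x \<in> messages. g x = a}" and eq: "\<phi> x = \<phi> x'"
    then have x: "x \<in> messages" "x' \<in> messages" "g x = g x'" by auto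
    have Y: "side_info R (S i) (C i) x = side_info R (S i) (C i) x'" if "i \<in> {1..N}" for i
      using fun_cong[OF eq, of i] that N by (auto simp: \<phi>_def)
    have low: "x i = x' i" if "i \<in> {1..N}" for i
      using dec[OF that] x Y[OF that] unfolding dec_def by blast
    have high: "x (N + i) = x' (N + i)" if "i \<in> {1..M - 1}" for i
      using that
    \<comment> \<open>Downward in \<open>i\<close>: apart from \<open>N + i\<close>, the set
      \<open>S i\<close> has only indices up to \<open>i\<close>, already decoded, and indices above
      \<open>N + i\<close>, covered by the induction hypothesis.\<close>
    proof (induction "K - i" arbitrary: i rule: less_induct)
      case less
      show ?case
      proof (cases "i \<le> N")
        case True
        then have i: "i \<in> {1..N}" using less.prems by simp
        show ?thesis
        proof (rule side_info_cancel[OF S(1)[OF i] C[OF i] x(1,2) Y[OF i] S(3)[OF i]])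
          fix k assume k: "k \<in> S i" "k \<noteq> N + i"
          show "x k = x' k"
          proof (cases "k \<le> N")
            case True
            then show ?thesis using k i by (intro low) (auto simp: S_def)
          next
            case False
            then have "k - N \<in> {1..M - 1}" "K - (k - N) < K - i" "N + (k - N) = k"
              using k i N by (auto simp: S_def)
            then show ?thesis using less.hyps[of "k - N"] by simp
          qed
        qed
      next
        case False
        then show ?thesis using fun_cong[OF eq, of i] less.prems by (simp add: \<phi>_def)
      qed
    qed
    show "x = x'"
    proof (rule messages_eqI[OF x(1,2)])
      fix i assume i: "i \<in> {1..K}"
      show "x i = x' i"
      proof (cases "i \<le> N")
        case True then show ?thesis using i by (intro low) auto
      next
        case False
        then have "i - N \<in> {1..M - 1}" using i N by auto
        then show ?thesis using high[of "i - N"] False by simp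
      qed
    qed
  qed
  ultimately have "card {x \<in> messages. g x = a} \<le> card ({1..M - 1} \<rightarrow>\<^sub>E carrier R)"
    by (intro card_inj_on_le) (auto intro: finite_PiE)
  then show ?thesis by (simp add: card_PiE)
qed

section \<open>Linear functionals of the messages and the bound for linear answers\<close>

definition eval_functional :: "(nat \<Rightarrow> int) \<Rightarrow> (nat \<Rightarrow> int) \<Rightarrow> int" where
  "eval_functional h x = (\<Oplus>i\<in>{1..K}. h i \<otimes> x i)"

definition lin_comb :: "int \<Rightarrow> (nat \<Rightarrow> int) \<Rightarrow> int \<Rightarrow> (nat \<Rightarrow> int) \<Rightarrow> nat \<Rightarrow> int" where
  "lin_comb \<alpha> u \<beta> v = (\<lambda>i. if i \<in> {1..K} then \<alpha> \<otimes> u i \<oplus> \<beta> \<otimes> v i else undefined)"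

definition zero_message :: "nat \<Rightarrow> int" where
  "zero_message = (\<lambda>i. if i \<in> {1..K} then \<zero> else undefined)"

lemma lin_comb_messages:
  "\<alpha> \<in> carrier R \<Longrightarrow> \<beta> \<in> carrier R \<Longrightarrow> u \<in> messages \<Longrightarrow> v \<in> messages \<Longrightarrow> lin_comb \<alpha> u \<beta> v \<in> messages"
  by (auto simp: messages_def PiE_dflt_def lin_comb_def)

lemma zero_message_messages: "zero_message \<in> messages"
  by (auto simp: messages_def PiE_dflt_def zero_message_def)

lemma finsum_lin_comb:
  assumes A: "A \<subseteq> {1..K}" and h: "\<And>i. i \<in> A \<Longrightarrow> h i \<in> carrier R"
    and "\<alpha> \<in> carrier R" "\<beta> \<in> carrier R" "u \<in> messages" "v \<in> messages"
  shows "(\<Oplus>i\<in>A. h i \<otimes> lin_comb \<alpha> u \<beta> v i) =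
    \<alpha> \<otimes> (\<Oplus>i\<in>A. h i \<otimes> u i) \<oplus> \<beta> \<otimes> (\<Oplus>i\<in>A. h i \<otimes> v i)"
proof -
  have [simp]: "h i \<in> carrier R" "u i \<in> carrier R" "v i \<in> carrier R" "lin_comb \<alpha> u \<beta> v i = \<alpha> \<otimes> u i \<oplus> \<beta> \<otimes> v i"
    if "i \<in> A" for i
    using that assms by (auto intro!: messages_carrier simp: lin_comb_def)
  have "finite A" using A finite_subset by blast
  have "(\<Oplus>i\<in>A. h i \<otimes> lin_comb \<alpha> u \<beta> v i) = (\<Oplus>i\<in>A. \<alpha> \<otimes> (h i \<otimes> u i) \<oplus> \<beta> \<otimes> (h i \<otimes> v i))"
    using assms by (intro finsum_cong') (auto simp: r_distr m_lcomm)
  also have "\<dots> = (\<Oplus>i\<in>A. \<alpha> \<otimes> (h i \<otimes> u i)) \<oplus> (\<Oplus>i\<in>A. \<beta> \<otimes> (h i \<otimes> v i))"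
    using assms by (intro finsum_addf) auto
  also have "\<dots> = \<alpha> \<otimes> (\<Oplus>i\<in>A. h i \<otimes> u i) \<oplus> \<beta> \<otimes> (\<Oplus>i\<in>A. h i \<otimes> v i)"
    using assms \<open>finite A\<close> by (simp add: finsum_rdistr Pi_iff)
  finally show ?thesis .
qed

lemma finsum_zero_message: "A \<subseteq> {1..K} \<Longrightarrow> (\<And>i. i \<in> A \<Longrightarrow> h i \<in> carrier R) \<Longrightarrow>
    (\<Oplus>i\<in>A. h i \<otimes> zero_message i) = \<zero>"
  by (rule add.finprod_one_eqI) (auto simp: zero_message_def)

text \<open>
  A minimal set \<open>T\<close> of messages which together with a linear answer determines all messages has
  fewer than \<open>M\<close> elements. Otherwise it contains a support, and for \<open>W\<close> and \<open>j\<close> in it the kernel has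
  elements \<open>d W\<close>, \<open>d j\<close> whose only nonzero entry in \<open>T\<close> is at \<open>W\<close> and \<open>j\<close>, respectively. A
  combination of them is invisible in the side information but not in the message \<open>W\<close>.
\<close>

lemma card_fibre_le_if_decodable_linear:
  assumes g: "decodable g"
    and Gs: "\<And>h i. h \<in> set Gs \<Longrightarrow> i \<in> {1..K} \<Longrightarrow> h i \<in> carrier R"
    and lin: "\<And>x. x \<in> messages \<Longrightarrow> g x = map (\<lambda>h. eval_functional h x) Gs"
  shows "card {x \<in> messages. g x = a} \<le> card (carrier R) ^ (M - 1)"
proof -
  define Ker where "Ker = {x \<in> messages. \<forall>h\<in>set Gs. eval_functional h x = \<zero>}"
  \<comment> \<open>\<open>P T\<close> says that \<open>T\<close> is an information set: a kernel
    vector is determined by its entries in \<open>T\<close>.\<close>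
  define P where "P T \<longleftrightarrow> T \<subseteq> {1..K} \<and> (\<forall>d\<in>Ker. (\<forall>i\<in>T. d i = \<zero>) \<longrightarrow> d = zero_message)" for T
  have eval_lin: "eval_functional h (lin_comb \<alpha> u \<beta> v) = \<alpha> \<otimes> eval_functional h u \<oplus> \<beta> \<otimes> eval_functional h v"
    if "h \<in> set Gs" "\<alpha> \<in> carrier R" "\<beta> \<in> carrier R" "u \<in> messages" "v \<in> messages" for h \<alpha> \<beta> u v
    unfolding eval_functional_def using that Gs by (intro finsum_lin_comb) auto
  have eval_carrier: "eval_functional h x \<in> carrier R" if "h \<in> set Gs" "x \<in> messages" for h x
    unfolding eval_functional_def by (intro finsum_closed Pi_I m_closed Gs messages_carrier that)
  have eval_zero: "eval_functional h zero_message = \<zero>" if "h \<in> set Gs" for h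
    unfolding eval_functional_def by (rule finsum_zero_message) (use that Gs in auto)
  have Ker_lin: "lin_comb \<alpha> u \<beta> v \<in> Ker" if "\<alpha> \<in> carrier R" "\<beta> \<in> carrier R" "u \<in> Ker" "v \<in> Ker" for \<alpha> \<beta> u v
    using that by (auto simp: Ker_def eval_lin lin_comb_messages)
  have "P {1..K}"
    unfolding P_def
  proof (intro conjI ballI impI subset_refl)
    fix d assume "d \<in> Ker" "\<forall>i\<in>{1..K}. d i = \<zero>"
    then show "d = zero_message"
      by (intro messages_eqI zero_message_messages) (auto simp: Ker_def zero_message_def)
  qed
  then obtain T where T: "P T" and min: "\<And>T'. P T' \<Longrightarrow> card T \<le> card T'"
    using ex_has_least_nat[of P "{1..K}" card] by blast
  have sub: "T \<subseteq> {1..K}" using T by (simp add: P_def)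
  then have fT: "finite T" using finite_subset by blast
  have "card T < M"
  proof (rule ccontr)
    assume "\<not> card T < M"
    then obtain S where S: "S \<subseteq> T" "card S = M"
      using obtain_subset_with_card_n[of M T] by (auto simp: not_less)
    then have SS: "S \<in> supports K M" using sub by (auto simp: supports_def)
    \<comment> \<open>The place where \<open>2 \<le> M\<close> is essential: a second index is
      needed to hide the change at \<open>W\<close>.\<close>
    have "\<not> (\<forall>i\<in>S. \<forall>j\<in>S. i = j)"
      using card_le_Suc0_iff_eq[OF supportsD(1)[OF SS]] S(2) M(1) by simp
    then obtain W j where WS: "W \<in> S" and jS: "j \<in> S" and Wj: "W \<noteq> j" by blast
    \<comment> \<open>By minimality \<open>T - {k}\<close> is no information set, so a nonzero
      kernel vector vanishes on it; vanishing at \<open>k\<close> too would contradict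
      \<open>P T\<close>.\<close>
    have "\<exists>d\<in>Ker. (\<forall>i\<in>T - {k}. d i = \<zero>) \<and> d k \<noteq> \<zero>" if k: "k \<in> T" for k
    proof -
      have "\<not> P (T - {k})" using min[of "T - {k}"] card_Diff1_less[OF fT k] by auto
      then obtain d where d: "d \<in> Ker" "\<forall>i\<in>T - {k}. d i = \<zero>" "d \<noteq> zero_message"
        using sub unfolding P_def by blast
      then have "d k \<noteq> \<zero>" using T unfolding P_def by blast
      with d show ?thesis by blast
    qed
    then have "\<forall>k\<in>T. \<exists>d. d \<in> Ker \<and> (\<forall>i\<in>T - {k}. d i = \<zero>) \<and> d k \<noteq> \<zero>" by blast
    then obtain d where "\<forall>k\<in>T. d k \<in> Ker \<and> (\<forall>i\<in>T - {k}. d k i = \<zero>) \<and> d k k \<noteq> \<zero>"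
      unfolding bchoice_iff by blast
    then have d: "\<And>k. k \<in> T \<Longrightarrow> d k \<in> Ker" "\<And>k i. k \<in> T \<Longrightarrow> i \<in> T \<Longrightarrow> i \<noteq> k \<Longrightarrow> d k i = \<zero>"
      "\<And>k. k \<in> T \<Longrightarrow> d k k \<noteq> \<zero>"
      by simp_all
    have dm: "d k \<in> messages" if "k \<in> T" for k using d(1)[OF that] by (simp add: Ker_def)
    have dc: "d k i \<in> carrier R" if "k \<in> T" "i \<in> T" for k i
      using messages_carrier[OF dm[OF that(1)]] that sub by blast
    obtain C where C: "C \<in> coefficient_seqs M R F" and dec: "\<forall>x\<in>messages. \<forall>x'\<in>messages.
      g x = g x' \<longrightarrow> side_info R S C x = side_info R S C x' \<longrightarrow> x W = x' W"
      using g[unfolded decodable_def, rule_format, OF SS WS] by (elim bexE)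
    let ?c = "coefficient_at S C"
    have T_in: "W \<in> T" "j \<in> T" using WS jS S by auto
    have [simp]: "?c W \<in> carrier R" "?c j \<in> carrier R" "d W W \<in> carrier R" "d j j \<in> carrier R"
      "d W j = \<zero>" "d j W = \<zero>"
      using SS C WS jS T_in Wj by (auto intro!: dc d(2))
    \<comment> \<open>The multipliers make the contributions of \<open>W\<close> and
      \<open>j\<close> to the side information cancel, whatever \<open>C\<close> is. Since
      \<open>?c j\<close> and \<open>d j j\<close> are nonzero, so is \<alpha>, and the entry at
      \<open>W\<close> survives.\<close>
    define \<alpha> where "\<alpha> = ?c j \<otimes> d j j"
    define \<beta> where "\<beta> = \<ominus> (?c W \<otimes> d W W)"
    have [simp]: "\<alpha> \<in> carrier R" "\<beta> \<in> carrier R" by (simp_all add: \<alpha>_def \<beta>_def)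
    define e where "e = lin_comb \<alpha> (d W) \<beta> (d j)"
    have eKer: "e \<in> Ker" unfolding e_def using T_in by (intro Ker_lin d) auto
    then have em: "e \<in> messages" by (simp add: Ker_def)
    have "g e = g zero_message"
      using eKer by (simp add: lin em zero_message_messages Ker_def eval_zero)
    moreover have "side_info R S C e = side_info R S C zero_message"
    proof -
      have single: "(\<Oplus>i\<in>S. ?c i \<otimes> d k i) = ?c k \<otimes> d k k" if "k \<in> S" for k
      proof -
        have kT: "k \<in> T" using that S by blast
        have "(\<Oplus>i\<in>S. ?c i \<otimes> d k i) = (\<Oplus>i\<in>S. if k = i then ?c i \<otimes> d k i else \<zero>)"
          using S kT d(2) SS C dc by (intro finsum_cong') (auto simp: subset_iff)
        also have "\<dots> = ?c k \<otimes> d k k"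
          using that supportsD(1)[OF SS] SS C dc S kT by (intro finsum_singleton) auto
        finally show ?thesis .
      qed
      have "side_info R S C e = \<alpha> \<otimes> (?c W \<otimes> d W W) \<oplus> \<beta> \<otimes> (?c j \<otimes> d j j)"
        using side_info_eq[OF SS C em] finsum_lin_comb[of S ?c \<alpha> \<beta> "d W" "d j"]
          supportsD(3)[OF SS] SS C T_in by (simp add: single WS jS dm e_def)
      also have "\<dots> = \<zero>"
        by (simp add: \<alpha>_def \<beta>_def l_minus m_comm[of "?c j \<otimes> d j j"] r_neg)
      finally show ?thesis
        using SS C supportsD(3)[OF SS]
        by (simp add: side_info_eq zero_message_messages finsum_zero_message)
    qed
    ultimately have "e W = zero_message W"
      using dec em zero_message_messages by blast
    then have "\<alpha> \<otimes> d W W = \<zero>"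
      using T_in sub by (auto simp: e_def lin_comb_def zero_message_def)
    moreover have "?c j \<noteq> \<zero>" using coefficient_at_in[OF SS C jS] by simp
    ultimately show False
      using d(3)[OF T_in(1)] d(3)[OF T_in(2)] by (simp add: \<alpha>_def integral_iff)
  qed
  have "(\<lambda>x. restrict x T) ` {x \<in> messages. g x = a} \<subseteq> T \<rightarrow>\<^sub>E carrier R"
    unfolding image_subset_iff restrict_PiE_iff using sub by (blast intro: messages_carrier)
  \<comment> \<open>Two points of a fibre differ by a kernel vector, which vanishes as soon as it
    vanishes on \<open>T\<close>.\<close>
  moreover have "inj_on (\<lambda>x. restrict x T) {x \<in> messages. g x = a}"
  proof (rule inj_onI)
    fix x x' assume "x \<in> {x \<in> messages. g x = a}" "x' \<in> {x \<in> messages. g x = a}" and eq: "restrict x T = restrict x' T"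
    then have x: "x \<in> messages" "x' \<in> messages" "g x = g x'" by auto
    have xc: "x i \<in> carrier R" "x' i \<in> carrier R" if "i \<in> {1..K}" for i
      using that x by (auto intro: messages_carrier)
    define d where "d = lin_comb \<one> x (\<ominus> \<one>) x'"
    have eq': "eval_functional h x = eval_functional h x'" if "h \<in> set Gs" for h
      using x that by (auto simp: lin)
    have "d \<in> Ker"
      using x by (auto simp: Ker_def d_def lin_comb_messages eval_lin eq' eval_carrier l_minus r_neg)
    moreover have "d i = \<zero>" if "i \<in> T" for i
      using fun_cong[OF eq, of i] that sub xc[of i] by (auto simp: d_def lin_comb_def l_minus r_neg subset_iff)
    ultimately have d0: "d = zero_message" using T unfolding P_def by blast
    show "x = x'"
    proof (rule messages_eqI[OF x(1,2)])
      fix i assume i: "i \<in> {1..K}"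
      have "x i \<oplus> \<ominus> x' i = \<zero>"
        using fun_cong[OF d0, of i] i xc[OF i] by (simp add: d_def lin_comb_def zero_message_def l_minus)
      then show "x i = x' i" using xc[OF i] by (metis minus_eq r_right_minus_eq)
    qed
  qed
  ultimately have "card {x \<in> messages. g x = a} \<le> card (T \<rightarrow>\<^sub>E carrier R)"
    using fT by (intro card_inj_on_le) (auto intro: finite_PiE)
  also have "\<dots> = card (carrier R) ^ card T" using fT by (simp add: card_PiE)
  also have "\<dots> \<le> card (carrier R) ^ (M - 1)"
    using \<open>card T < M\<close> card_carrier_gt_1 by (intro power_increasing) auto
  finally show ?thesis .
qed

lemma rate_le_general:
  assumes "pir_pcsi_II K M R F query answer" and "K + 2 \<le> 2 * M"
  shows "rate K M q l R F query answer \<le> ereal (inverse (real K - real M + 1))"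
  by (rule rate_le_if_card_fibre_le, rule card_fibre_le_if_decodable[OF decodable_answer[OF assms(1)] assms(2)])

lemma rate_le_scalar_linear:
  assumes pir: "pir_pcsi_II K M R F query answer" and "scalar_linear K M R F query answer"
  shows "rate K M q l R F query answer \<le> ereal (inverse (real K - real M + 1))"
proof (rule rate_le_if_card_fibre_le)
  fix Q a assume Q: "Q \<in> rv_Q ` set_pmf (model_II K M R F query)"
  obtain G where "\<forall>Q. \<forall>h\<in>set (G Q). \<forall>i\<in>{1..K}. h i \<in> F"
    and "\<forall>\<omega>\<in>set_pmf (model_II K M R F query).
      rv_A answer \<omega> = map (\<lambda>h. eval_functional h (rv_X \<omega>)) (G (rv_Q \<omega>))"
    using assms(2) unfolding scalar_linear_def eval_functional_def by blast
  then have G: "\<And>Q h i. h \<in> set (G Q) \<Longrightarrow> i \<in> {1..K} \<Longrightarrow> h i \<in> F"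
    "\<And>\<omega>. \<omega> \<in> set_pmf (model_II K M R F query) \<Longrightarrow>
      rv_A answer \<omega> = map (\<lambda>h. eval_functional h (rv_X \<omega>)) (G (rv_Q \<omega>))"
    by blast+
  show "card {x \<in> messages. answer Q True x = a} \<le> card (carrier R) ^ (M - 1)"
  proof (rule card_fibre_le_if_decodable_linear[OF decodable_answer[OF pir Q]])
    show "h i \<in> carrier R" if "h \<in> set (G Q)" "i \<in> {1..K}" for h i
      using G(1)[OF that] F_subset by blast
    show "answer Q True x = map (\<lambda>h. eval_functional h x) (G Q)" if x: "x \<in> messages" for x
    proof -
      obtain \<omega> where \<omega>: "\<omega> \<in> set_pmf (model_II K M R F query)" "Q = rv_Q \<omega>" using Q by blast
      \<comment> \<open>Linearity is given on outcomes only. Exchanging the messages of an outcome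
        with query \<open>Q\<close> yields another outcome, which covers every
        \<open>x\<close>.\<close>
      have "\<omega>\<lparr>rv_X := x\<rparr> \<in> set_pmf (model_II K M R F query)"
        using \<omega> x by (simp add: set_pmf_model_II)
      from G(2)[OF this] show ?thesis
        using \<omega> by (simp add: rv_A_def set_pmf_model_II)
    qed
  qed
qed

end

section \<open>A protocol from generalised Reed-Solomon codes\<close>

lemma pair_pmf_of_set:
  assumes "finite A" "A \<noteq> {}" "finite B" "B \<noteq> {}"
  shows "pair_pmf (pmf_of_set A) (pmf_of_set B) = pmf_of_set (A \<times> B)"
proof (rule pmf_eqI)
  fix z show "pmf (pair_pmf (pmf_of_set A) (pmf_of_set B)) z = pmf (pmf_of_set (A \<times> B)) z"
    using assms by (cases z) (simp add: pmf_pair indicator_times card_cartesian_product)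
qed

locale grs_scheme =
  fixes K M p :: nat
  assumes M2: "2 \<le> M" and MK: "M \<le> K" and prime_p: "prime p" and Kp: "K < p"

sublocale grs_scheme \<subseteq> residues_prime p "residue_ring (int p)"
  by unfold_locales (simp_all add: prime_p)

sublocale grs_scheme \<subseteq> pcsi_setting K M p 1 "residue_ring (int p)" "carrier (residue_ring (int p))"
  using carrier_is_subfield by unfold_locales (simp_all add: M2 MK field_pair_def prime_p is_field res_carrier_eq)

context grs_scheme
begin

abbreviation Zp :: "int ring" where "Zp \<equiv> residue_ring (int p)"

definition multipliers :: "(nat \<Rightarrow> int) set" where
  "multipliers = {1..K} \<rightarrow>\<^sub>E {1..int p - 1}"

text \<open>
  Multiplied by \<open>\<nu> i\<close>, the values at \<open>i\<close> of the polynomial with roots \<open>{1..K} - S\<close> form a codeword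
  with support \<open>S\<close> of the generalised Reed-Solomon code with multipliers \<open>\<nu>\<close>. The side information
  coefficients agree with that codeword except for a factor 2 at the demand index \<open>W\<close>.
\<close>

definition root_poly :: "nat set \<Rightarrow> int poly" where
  "root_poly S = (\<Prod>j\<in>{1..K} - S. [:- int j, 1:])"

definition codeword :: "nat set \<Rightarrow> (nat \<Rightarrow> int) \<Rightarrow> nat \<Rightarrow> int" where
  "codeword S \<nu> i = poly (root_poly S) (int i) * \<nu> i"

definition side_coeff :: "nat set \<Rightarrow> nat \<Rightarrow> (nat \<Rightarrow> int) \<Rightarrow> nat \<Rightarrow> int" where
  "side_coeff S W \<nu> i = ((if i = W then 2 else 1) * codeword S \<nu> i) mod int p"

text \<open>The coupling: multipliers on \<open>S\<close> are encoded as side information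
  coefficients, the others stay free. The user inverts this map to find a query that matches its
  \<open>C\<close>.\<close>

definition split_multipliers :: "nat set \<Rightarrow> nat \<Rightarrow> (nat \<Rightarrow> int) \<Rightarrow> int list \<times> (nat \<Rightarrow> int)" where
  "split_multipliers S W \<nu> = (map (side_coeff S W \<nu>) (sorted_list_of_set S), restrict \<nu> ({1..K} - S))"

definition free_multipliers :: "nat set \<Rightarrow> (nat \<Rightarrow> int) set" where
  "free_multipliers S = ({1..K} - S) \<rightarrow>\<^sub>E {1..int p - 1}"

definition grs_query :: query_fun where
  "grs_query W S C = map_pmf (\<lambda>g. to_nat_on multipliers (inv_into multipliers (split_multipliers S W) (C, g)))
     (pmf_of_set (free_multipliers S))"

text \<open>Entry \<open>(t, i)\<close> of the generator matrix: a Vandermonde matrix whose column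
  \<open>i\<close> is scaled by its multiplier. The rows \<open>t \<le> K - M\<close> span the
  scaled evaluations of all polynomials of degree at most \<open>K - M\<close>.\<close>

definition grs_coeff :: "nat \<Rightarrow> nat \<Rightarrow> nat \<Rightarrow> int" where
  "grs_coeff Q t i = (from_nat_into multipliers Q i * int i ^ t) mod int p"

definition grs_answer :: answer_fun where
  "grs_answer Q b x = map (\<lambda>t. eval_functional (grs_coeff Q t) x) [0..<K - M + 1]"

section \<open>The coupling of multipliers and side information, and privacy\<close>

lemma p_gt_2: "2 < p" using M2 MK Kp by simp

lemma coefficient_seqs_Zp:
  "coefficient_seqs M Zp (carrier Zp) = {C. set C \<subseteq> {1..int p - 1} \<and> length C = M}"
  unfolding coefficient_seqs_def res_carrier_eq res_zero_eq by auto

lemma finite_multipliers [simp]: "finite multipliers"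
  unfolding multipliers_def by (intro finite_PiE) auto

lemma finite_free_multipliers [simp]: "finite (free_multipliers S)"
  unfolding free_multipliers_def
  by (intro finite_PiE) auto

lemma free_multipliers_nonempty: "free_multipliers S \<noteq> {}"
  using p_gt_2 by (auto simp: free_multipliers_def PiE_eq_empty_iff)

lemma not_dvd_nonzero_residue: "a \<in> {1..int p - 1} \<Longrightarrow> \<not> int p dvd a"
  using zdvd_not_zless[of a "int p"] by auto

text \<open>Distinct indices in \<open>{1..K}\<close> differ by less than \<open>p\<close>, so no
  factor of the product is divisible by \<open>p\<close>.\<close>

lemma not_dvd_root_poly:
  assumes "i \<in> S" "S \<subseteq> {1..K}"
  shows "\<not> int p dvd poly (root_poly S) (int i)"
proof
  have "i \<in> {1..K}" using assms by blast
  assume "int p dvd poly (root_poly S) (int i)"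
  then have "int p dvd (\<Prod>j\<in>{1..K} - S. int i - int j)"
    by (simp add: root_poly_def poly_prod)
  then obtain j where j: "j \<in> {1..K} - S" "int p dvd int i - int j"
    using prime_p by (auto simp: prime_dvd_prod_iff)
  then have "int i - int j \<noteq> 0" "\<bar>int i - int j\<bar> < int p"
    using assms Kp \<open>i \<in> {1..K}\<close> by auto
  then show False
    using dvd_imp_le_int[OF _ j(2)] by simp
qed

lemma poly_root_poly_eq_0: "i \<in> {1..K} - S \<Longrightarrow> poly (root_poly S) (int i) = 0"
  unfolding root_poly_def poly_prod by (rule prod_zero) auto

lemma degree_root_poly:
  assumes "S \<in> supports K M"
  shows "degree (root_poly S) = K - M"
proof -
  have "degree (root_poly S) = (\<Sum>j\<in>{1..K} - S. degree [:- int j, 1:])"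
    unfolding root_poly_def by (rule degree_prod_eq_sum_degree) auto
  also have "\<dots> = card ({1..K} - S)" by simp
  also have "\<dots> = K - M"
    using supportsD[OF assms] by (simp add: card_Diff_subset)
  finally show ?thesis .
qed

lemma dvd_mult_iff: "int p dvd a * b \<longleftrightarrow> int p dvd a \<or> int p dvd b"
  using prime_p by (simp add: prime_dvd_mult_iff)

lemma not_dvd_2: "\<not> int p dvd 2"
  using p_gt_2 by (intro zdvd_not_zless) auto

lemma side_coeff_range:
  assumes "\<nu> \<in> multipliers" "i \<in> S" "S \<subseteq> {1..K}"
  shows "side_coeff S W \<nu> i \<in> {1..int p - 1}"
proof -
  have "\<nu> i \<in> {1..int p - 1}" using assms by (auto simp: multipliers_def)
  then have "\<not> int p dvd (if i = W then 2 else 1) * codeword S \<nu> i"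
    using not_dvd_nonzero_residue not_dvd_root_poly[OF assms(2,3)] not_dvd_2 p_gt_2
    by (auto simp: codeword_def dvd_mult_iff)
  then have "side_coeff S W \<nu> i \<noteq> 0"
    unfolding side_coeff_def by (simp add: dvd_eq_mod_eq_0)
  moreover have "0 \<le> side_coeff S W \<nu> i" "side_coeff S W \<nu> i < int p"
    using p_gt_2 by (simp_all add: side_coeff_def)
  ultimately show ?thesis by auto
qed

lemma residue_eqI:
  assumes "int p dvd a - b" "a \<in> {0..int p - 1}" "b \<in> {0..int p - 1}"
  shows "a = b"
proof (rule ccontr)
  assume "a \<noteq> b"
  then show False using dvd_imp_le_int[OF _ assms(1)] assms(2,3) by auto
qed

text \<open>Off \<open>S\<close> the multipliers are kept verbatim; on \<open>S\<close> they are
  scaled by units modulo \<open>p\<close>.\<close>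

lemma inj_on_split_multipliers:
  assumes "S \<in> supports K M"
  shows "inj_on (split_multipliers S W) multipliers"
proof (rule inj_onI)
  fix \<nu> \<mu> assume \<nu>: "\<nu> \<in> multipliers" and \<mu>: "\<mu> \<in> multipliers"
    and eq: "split_multipliers S W \<nu> = split_multipliers S W \<mu>"
  note S = supportsD[OF assms]
  show "\<nu> = \<mu>"
  proof (rule PiE_ext[OF \<nu>[unfolded multipliers_def] \<mu>[unfolded multipliers_def]])
    fix i assume i: "i \<in> {1..K}"
    have \<nu>i: "\<nu> i \<in> {1..int p - 1}" "\<mu> i \<in> {1..int p - 1}"
      using \<nu> \<mu> i unfolding multipliers_def by blast+
    show "\<nu> i = \<mu> i"
    proof (cases "i \<in> S")
      case True
      then have "side_coeff S W \<nu> i = side_coeff S W \<mu> i"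
        using eq S(1) by (auto simp: split_multipliers_def)
      then have "int p dvd (if i = W then 2 else 1) * codeword S \<nu> i - (if i = W then 2 else 1) * codeword S \<mu> i"
        unfolding side_coeff_def by (simp add: mod_eq_dvd_iff)
      then have "int p dvd (if i = W then 2 else 1) * poly (root_poly S) (int i) * (\<nu> i - \<mu> i)"
        by (simp add: codeword_def algebra_simps)
      then have "int p dvd \<nu> i - \<mu> i"
        using not_dvd_root_poly[OF True S(3)] not_dvd_2 p_gt_2 by (auto simp: dvd_mult_iff split: if_splits)
      then show ?thesis
        using \<nu>i by (intro residue_eqI) auto
    next
      case False
      have "restrict \<nu> ({1..K} - S) = restrict \<mu> ({1..K} - S)"
        using eq by (simp add: split_multipliers_def)
      from fun_cong[OF this, of i] show ?thesis
        using i False by simp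
    qed
  qed
qed

text \<open>Injectivity suffices, since
  \<open>(p - 1) ^ M * (p - 1) ^ (K - M) = (p - 1) ^ K\<close>.\<close>

lemma bij_betw_split_multipliers:
  assumes "S \<in> supports K M"
  shows "bij_betw (split_multipliers S W) multipliers
    (coefficient_seqs M Zp (carrier Zp) \<times> free_multipliers S)"
proof -
  note S = supportsD[OF assms]
  let ?B = "coefficient_seqs M Zp (carrier Zp) \<times> free_multipliers S"
  have sub: "split_multipliers S W ` multipliers \<subseteq> ?B"
  proof (rule image_subsetI)
    fix \<nu> assume \<nu>: "\<nu> \<in> multipliers"
    then have "restrict \<nu> ({1..K} - S) \<in> free_multipliers S"
      by (auto simp: multipliers_def free_multipliers_def)
    moreover have "map (side_coeff S W \<nu>) (sorted_list_of_set S) \<in> coefficient_seqs M Zp (carrier Zp)"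
      using side_coeff_range[OF \<nu> _ S(3)] S(1,4) by (auto simp: coefficient_seqs_Zp)
    ultimately show "split_multipliers S W \<nu> \<in> ?B" by (simp add: split_multipliers_def)
  qed
  have "card (coefficient_seqs M Zp (carrier Zp)) = (p - 1) ^ M"
    unfolding coefficient_seqs_Zp by (subst card_lists_length_eq) (auto simp: nat_diff_distrib')
  moreover have "card (free_multipliers S) = (p - 1) ^ (K - M)"
    using S by (simp add: free_multipliers_def card_PiE card_Diff_subset nat_diff_distrib')
  moreover have "card multipliers = (p - 1) ^ K"
    by (simp add: multipliers_def card_PiE nat_diff_distrib')
  ultimately have "card (split_multipliers S W ` multipliers) = card ?B"
    using MK by (simp add: card_image[OF inj_on_split_multipliers[OF assms]] card_cartesian_product
        flip: power_add)
  then have "split_multipliers S W ` multipliers = ?B"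
    using sub by (intro card_subset_eq) auto
  then show ?thesis
    using inj_on_split_multipliers[OF assms] by (simp add: bij_betw_def)
qed

text \<open>The bijection carries uniform coefficients and uniform free multipliers to uniform
  multipliers. The right-hand side mentions neither \<open>S\<close> nor \<open>W\<close>, and
  privacy follows from this.\<close>

lemma query_uniform:
  assumes "S \<in> supports K M"
  shows "bind_pmf (pmf_of_set (coefficient_seqs M Zp (carrier Zp))) (grs_query W S) =
    map_pmf (to_nat_on multipliers) (pmf_of_set multipliers)"
proof -
  let ?C = "coefficient_seqs M Zp (carrier Zp)" and ?B = "free_multipliers S"
  let ?inv = "inv_into multipliers (split_multipliers S W)"
  have "bind_pmf (pmf_of_set ?C) (grs_query W S) =
      map_pmf (to_nat_on multipliers) (map_pmf ?inv (pair_pmf (pmf_of_set ?C) (pmf_of_set ?B)))"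
    unfolding grs_query_def[abs_def] pair_pmf_def map_pmf_def
    by (simp add: bind_assoc_pmf bind_return_pmf)
  also have "map_pmf ?inv (pair_pmf (pmf_of_set ?C) (pmf_of_set ?B)) = pmf_of_set multipliers"
    unfolding pair_pmf_of_set[OF finite_coefficient_seqs coefficient_seqs_nonempty
        finite_free_multipliers free_multipliers_nonempty]
    by (rule map_pmf_of_set_bij_betw[OF bij_betw_inv_into[OF bij_betw_split_multipliers[OF assms]]])
      (auto simp: free_multipliers_nonempty)
  finally show ?thesis .
qed

lemma grs_WS_privacy: "WS_privacy K M Zp (carrier Zp) grs_query"
  unfolding WS_privacy_def
proof (rule conditional_mutual_information_bits_eq_0I)
  let ?C = "coefficient_seqs M Zp (carrier Zp)"
  let ?U = "map_pmf (to_nat_on multipliers) (pmf_of_set multipliers)"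
  have "map_pmf (\<lambda>\<omega>. ((rv_W \<omega>, rv_S \<omega>), rv_Q \<omega>)) (model_II K M Zp (carrier Zp) grs_query) =
      bind_pmf (pmf_of_set (supports K M)) (\<lambda>S. bind_pmf (pmf_of_set S) (\<lambda>W.
        map_pmf (Pair (W, S)) (bind_pmf (pmf_of_set ?C) (grs_query W S))))"
    unfolding model_II_def by (simp add: map_bind_pmf map_pmf_def bind_assoc_pmf bind_return_pmf)
  also have "\<dots> = bind_pmf (pmf_of_set (supports K M)) (\<lambda>S. bind_pmf (pmf_of_set S) (\<lambda>W.
        map_pmf (Pair (W, S)) ?U))"
    by (intro bind_pmf_cong refl) (simp add: query_uniform)
  also have "\<dots> = pair_pmf (bind_pmf (pmf_of_set (supports K M)) (\<lambda>S. map_pmf (\<lambda>W. (W, S)) (pmf_of_set S))) ?U"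
    by (simp add: pair_pmf_def map_pmf_def bind_assoc_pmf bind_return_pmf)
  finally show "map_pmf (\<lambda>\<omega>. ((rv_W \<omega>, rv_S \<omega>), rv_Q \<omega>)) (model_II K M Zp (carrier Zp) grs_query) =
    pair_pmf (bind_pmf (pmf_of_set (supports K M)) (\<lambda>S. map_pmf (\<lambda>W. (W, S)) (pmf_of_set S))) ?U" .
  show "rv_ind \<omega> = True" if "\<omega> \<in> set_pmf (model_II K M Zp (carrier Zp) grs_query)" for \<omega>
    using that by (simp add: set_pmf_model_II)
qed

section \<open>Decoding and the rate of the scheme\<close>

lemma finsum_mult_eq_mod:
  assumes "finite A"
  shows "(\<Oplus>\<^bsub>Zp\<^esub>i\<in>A. c i \<otimes>\<^bsub>Zp\<^esub> x i) = (\<Sum>i\<in>A. c i * x i) mod int p"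
  using sum_cong[OF assms] by (simp add: res_mult_eq)

text \<open>Equal answers give the divisibility for each power \<open>i ^ t\<close> with
  \<open>t \<le> K - M\<close>; polynomials of degree at most \<open>K - M\<close> follow by
  linearity.\<close>

lemma grs_answer_dvd:
  assumes eq: "grs_answer Q b x = grs_answer Q b x'" and f: "degree f \<le> K - M"
  shows "int p dvd (\<Sum>i\<in>{1..K}. poly f (int i) * from_nat_into multipliers Q i * (x i - x' i))"
proof -
  let ?\<nu> = "from_nat_into multipliers Q"
  have t: "int p dvd (\<Sum>i\<in>{1..K}. ?\<nu> i * int i ^ t * (x i - x' i))" if "t \<le> K - M" for t
  proof -
    have "eval_functional (grs_coeff Q t) x = eval_functional (grs_coeff Q t) x'"
      using eq that by (auto simp: grs_answer_def)
    then have "int p dvd (\<Sum>i\<in>{1..K}. grs_coeff Q t i * x i) - (\<Sum>i\<in>{1..K}. grs_coeff Q t i * x' i)"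
      unfolding eval_functional_def finsum_mult_eq_mod[OF finite_atLeastAtMost] by (simp only: mod_eq_dvd_iff)
    also have "(\<Sum>i\<in>{1..K}. grs_coeff Q t i * x i) - (\<Sum>i\<in>{1..K}. grs_coeff Q t i * x' i) =
        (\<Sum>i\<in>{1..K}. grs_coeff Q t i * (x i - x' i))"
      by (simp add: sum_subtractf right_diff_distrib)
    finally have "(\<Sum>i\<in>{1..K}. grs_coeff Q t i * (x i - x' i)) mod int p = 0"
      by (simp only: dvd_eq_mod_eq_0)
    moreover have "(\<Sum>i\<in>{1..K}. grs_coeff Q t i * (x i - x' i)) mod int p =
        (\<Sum>i\<in>{1..K}. ?\<nu> i * int i ^ t * (x i - x' i)) mod int p"
      by (rule Cong.cong_sum[unfolded cong_def]) (simp add: grs_coeff_def mod_mult_left_eq)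
    ultimately show ?thesis by (simp only: dvd_eq_mod_eq_0)
  qed
  have "(\<Sum>i\<in>{1..K}. poly f (int i) * ?\<nu> i * (x i - x' i)) =
      (\<Sum>i\<in>{1..K}. \<Sum>t\<le>degree f. poly.coeff f t * (?\<nu> i * int i ^ t * (x i - x' i)))"
    by (simp add: poly_altdef sum_distrib_left sum_distrib_right mult_ac)
  also have "\<dots> = (\<Sum>t\<le>degree f. poly.coeff f t * (\<Sum>i\<in>{1..K}. ?\<nu> i * int i ^ t * (x i - x' i)))"
    by (subst sum.swap) (simp add: sum_distrib_left)
  also have "int p dvd \<dots>"
    using f by (intro dvd_sum dvd_mult t) simp
  finally show ?thesis .
qed

text \<open>Modulo \<open>p\<close>, the difference of the message vectors is orthogonal to the
  codeword, by the answer, and to the side information coefficients. These two vectors differ only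
  at \<open>W\<close>, by a unit, so the difference vanishes there.\<close>

lemma grs_decode:
  assumes S: "S \<in> supports K M" and W: "W \<in> S" and \<nu>: "\<nu> \<in> multipliers"
    and Q: "Q = to_nat_on multipliers \<nu>" and C: "C = map (side_coeff S W \<nu>) (sorted_list_of_set S)"
      "C \<in> coefficient_seqs M Zp (carrier Zp)"
    and x: "x \<in> messages" "x' \<in> messages"
    and eq: "grs_answer Q b x = grs_answer Q b x'" "side_info Zp S C x = side_info Zp S C x'"
  shows "x W = x' W"
proof -
  note S' = supportsD[OF S]
  define d where "d i = x i - x' i" for i
  have "from_nat_into multipliers Q = \<nu>"
    using \<nu> by (simp add: Q countable_finite)
  then have "int p dvd (\<Sum>i\<in>{1..K}. codeword S \<nu> i * d i)"
    using grs_answer_dvd[OF eq(1), of "root_poly S"] degree_root_poly[OF S]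
    by (simp add: codeword_def d_def)
  also have "(\<Sum>i\<in>{1..K}. codeword S \<nu> i * d i) = (\<Sum>i\<in>S. codeword S \<nu> i * d i)"
    using S'(3) by (intro sum.mono_neutral_right) (auto simp: codeword_def poly_root_poly_eq_0)
  finally have 1: "int p dvd (\<Sum>i\<in>S. codeword S \<nu> i * d i)" .
  have "side_info Zp S C y = (\<Sum>i\<in>S. side_coeff S W \<nu> i * y i) mod int p" if "y \<in> messages" for y
  proof -
    have "side_info Zp S C y = (\<Sum>i\<in>S. coefficient_at S C i * y i) mod int p"
      unfolding side_info_eq[OF S C(2) that] by (rule finsum_mult_eq_mod[OF S'(1)])
    then show ?thesis
      using S'(1) by (simp add: C(1) coefficient_at_map cong: sum.cong)
  qed
  then have "int p dvd (\<Sum>i\<in>S. side_coeff S W \<nu> i * x i) - (\<Sum>i\<in>S. side_coeff S W \<nu> i * x' i)"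
    using eq(2) x by (simp add: mod_eq_dvd_iff)
  then have "(\<Sum>i\<in>S. side_coeff S W \<nu> i * d i) mod int p = 0"
    by (simp add: d_def sum_subtractf right_diff_distrib dvd_eq_mod_eq_0)
  moreover have "(\<Sum>i\<in>S. side_coeff S W \<nu> i * d i) mod int p =
      (\<Sum>i\<in>S. (if i = W then 2 else 1) * codeword S \<nu> i * d i) mod int p"
    by (rule Cong.cong_sum[unfolded cong_def]) (simp add: side_coeff_def mod_mult_left_eq)
  ultimately have "int p dvd (\<Sum>i\<in>S. (if i = W then 2 else 1) * codeword S \<nu> i * d i)"
    by (simp only: dvd_eq_mod_eq_0)
  \<comment> \<open>Twice the codeword entry at \<open>W\<close> is one copy that completes the
    codeword sum and one extra copy, which alone survives.\<close>
  also have "(\<Sum>i\<in>S. (if i = W then 2 else 1) * codeword S \<nu> i * d i) =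
      (\<Sum>i\<in>S. codeword S \<nu> i * d i + (if i = W then codeword S \<nu> W * d W else 0))"
    by (intro sum.cong) auto
  also have "\<dots> = (\<Sum>i\<in>S. codeword S \<nu> i * d i) + codeword S \<nu> W * d W"
    using S'(1) W by (simp add: sum.distrib)
  finally have "int p dvd codeword S \<nu> W * d W"
    using 1 by (simp add: dvd_add_right_iff)
  moreover have "\<not> int p dvd \<nu> W"
    using \<nu> W S'(3) by (intro not_dvd_nonzero_residue) (auto simp: multipliers_def)
  ultimately have "int p dvd x W - x' W"
    using not_dvd_root_poly[OF W S'(3)] by (simp add: codeword_def dvd_mult_iff d_def)
  then show ?thesis
    by (rule residue_eqI)
      (use messages_carrier_support[OF x(1) S W] messages_carrier_support[OF x(2) S W] in \<open>simp_all add: res_carrier_eq\<close>)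
qed

lemma grs_query_support:
  assumes S: "S \<in> supports K M" and C: "C \<in> coefficient_seqs M Zp (carrier Zp)"
    and Q: "Q \<in> set_pmf (grs_query W S C)"
  shows "\<exists>\<nu>\<in>multipliers. Q = to_nat_on multipliers \<nu> \<and> C = map (side_coeff S W \<nu>) (sorted_list_of_set S)"
proof -
  obtain g where g: "g \<in> free_multipliers S"
    and Q': "Q = to_nat_on multipliers (inv_into multipliers (split_multipliers S W) (C, g))"
    using Q by (auto simp: grs_query_def set_pmf_of_set[OF free_multipliers_nonempty])
  have im: "(C, g) \<in> split_multipliers S W ` multipliers"
    using bij_betw_split_multipliers[OF S, of W] C g by (simp add: bij_betw_def)
  let ?\<nu> = "inv_into multipliers (split_multipliers S W) (C, g)"
  have "?\<nu> \<in> multipliers" using im by (rule inv_into_into)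
  moreover have "split_multipliers S W ?\<nu> = (C, g)" using im by (rule f_inv_into_f)
  ultimately show ?thesis using Q' by (auto simp: split_multipliers_def)
qed

lemma grs_recoverability: "recoverability K M Zp (carrier Zp) grs_query grs_answer"
  unfolding recoverability_def
proof (rule conditional_entropy_bits_eq_0I)
  fix \<omega> \<omega>'
  assume \<omega>: "\<omega> \<in> set_pmf (model_II K M Zp (carrier Zp) grs_query)"
    "\<omega>' \<in> set_pmf (model_II K M Zp (carrier Zp) grs_query)"
    and eq: "(rv_A grs_answer \<omega>, rv_Q \<omega>, rv_ind \<omega>, rv_Y Zp \<omega>, rv_W \<omega>, rv_S \<omega>, rv_C \<omega>) =
      (rv_A grs_answer \<omega>', rv_Q \<omega>', rv_ind \<omega>', rv_Y Zp \<omega>', rv_W \<omega>', rv_S \<omega>', rv_C \<omega>')"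
  have S: "rv_S \<omega> \<in> supports K M" "rv_W \<omega> \<in> rv_S \<omega>" and C: "rv_C \<omega> \<in> coefficient_seqs M Zp (carrier Zp)"
    and Q: "rv_Q \<omega> \<in> set_pmf (grs_query (rv_W \<omega>) (rv_S \<omega>) (rv_C \<omega>))" and x: "rv_X \<omega> \<in> messages" "rv_X \<omega>' \<in> messages"
    using \<omega> by (simp_all add: set_pmf_model_II)
  obtain \<nu> where \<nu>: "\<nu> \<in> multipliers" "rv_Q \<omega> = to_nat_on multipliers \<nu>"
    "rv_C \<omega> = map (side_coeff (rv_S \<omega>) (rv_W \<omega>) \<nu>) (sorted_list_of_set (rv_S \<omega>))"
    using grs_query_support[OF S(1) C Q] by blast
  have "rv_X \<omega> (rv_W \<omega>) = rv_X \<omega>' (rv_W \<omega>)"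
    by (rule grs_decode[OF S \<nu> C x, of True]) (use eq S in \<open>auto simp: rv_A_def rv_Y_def\<close>)
  then show "rv_X \<omega> (rv_W \<omega>) = rv_X \<omega>' (rv_W \<omega>')" using eq by simp
qed

lemma grs_scalar_linear: "scalar_linear K M Zp (carrier Zp) grs_query grs_answer"
  unfolding scalar_linear_def
  by (rule exI[of _ "\<lambda>Q. map (\<lambda>t. grs_coeff Q t) [0..<K - M + 1]"])
    (auto simp: grs_coeff_def rv_A_def grs_answer_def eval_functional_def simp del: upt_Suc)

lemma le_rate_grs:
  "ereal (inverse (real K - real M + 1)) \<le> rate K M p 1 Zp (carrier Zp) grs_query grs_answer"
proof -
  define N where "N = K - M + 1"
  define H where "H = entropy_bits (model_II K M Zp (carrier Zp) grs_query) (rv_A grs_answer)"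
  define L where "L = log 2 (real p)"
  let ?B = "{a. set a \<subseteq> carrier Zp \<and> length a = N}"
  have N: "0 < N" "real N = real K - real M + 1" using MK by (simp_all add: N_def of_nat_diff)
  have L: "0 < L" using p_gt_2 by (simp add: L_def)
  have "rv_A grs_answer ` set_pmf (model_II K M Zp (carrier Zp) grs_query) \<subseteq> ?B"
    by (auto simp: rv_A_def grs_answer_def eval_functional_def N_def finsum_mult_eq_mod[OF finite_atLeastAtMost]
        simp del: upt_Suc One_nat_def)
  then have "H \<le> ereal (log 2 (card ?B))"
    unfolding H_def by (intro entropy_bits_le_log_card finite_lists_length_eq finite_carrier) auto
  also have "card ?B = p ^ N"
    by (subst card_lists_length_eq) (auto simp: field_pair_facts)
  finally have upper: "H \<le> ereal (N * L)"
    using p_gt_2 by (simp add: log_nat_power L_def)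
  have lower: "0 \<le> H"
    using log_le_entropy_bits[of 1 "rv_A grs_answer" "model_II K M Zp (carrier Zp) grs_query"]
    by (simp add: H_def pmf_le_1 zero_ereal_def)
  obtain h where h: "H = ereal h" "0 \<le> h" "h \<le> N * L"
    using upper lower by (cases H) auto
  \<comment> \<open>If the entropy \<open>h\<close> is 0, division in \<open>ereal\<close> makes the
    right-hand side infinite, so the bound holds there too.\<close>
  have "ereal (inverse N) \<le> ereal L / ereal h"
  proof (cases "h = 0")
    case False
    then have "inverse N \<le> L / h"
      using h N(1) by (simp add: field_simps)
    then show ?thesis using False by simp
  qed (use L in \<open>simp add: divide_ereal_def\<close>)
  then show ?thesis
    by (simp add: rate_def entropy_given_event_model_II L_def flip: N(2) H_def h(1))
qed

end

section \<open>The capacities as suprema of rates\<close>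

lemma rate_le_scalar_linear_capacity:
  assumes "field_pair q l R F" "pir_pcsi_II K M R F query answer" "scalar_linear K M R F query answer"
  shows "rate K M q l R F query answer \<le> scalar_linear_capacity K M"
  unfolding scalar_linear_capacity_def using assms by (intro Sup_upper) blast

lemma le_scalar_linear_capacity:
  assumes "2 \<le> M" "M \<le> K"
  shows "ereal (inverse (real K - real M + 1)) \<le> scalar_linear_capacity K M"
proof -
  obtain p where p: "prime p" "K < p" using bigger_prime by blast
  interpret grs_scheme K M p
    by unfold_locales (use assms p in auto)
  note le_rate_grs
  also have "rate K M p 1 Zp (carrier Zp) grs_query grs_answer \<le> scalar_linear_capacity K M"
    using fp grs_recoverability grs_WS_privacy grs_scalar_linear
    by (intro rate_le_scalar_linear_capacity) (auto simp only: pir_pcsi_II_def)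
  finally show ?thesis .
qed

lemma scalar_linear_capacity_le_capacity: "scalar_linear_capacity K M \<le> capacity K M"
  unfolding scalar_linear_capacity_def capacity_def by (rule Sup_subset_mono) blast

lemma scalar_linear_capacity_le:
  assumes "2 \<le> M" "M \<le> K"
  shows "scalar_linear_capacity K M \<le> ereal (inverse (real K - real M + 1))"
  unfolding scalar_linear_capacity_def
  using assms by (intro Sup_least) (auto intro!: pcsi_setting.rate_le_scalar_linear pcsi_setting.intro)

lemma capacity_le:
  assumes "2 \<le> M" "M \<le> K" "K + 2 \<le> 2 * M"
  shows "capacity K M \<le> ereal (inverse (real K - real M + 1))"
  unfolding capacity_def
  using assms by (intro Sup_least) (auto intro!: pcsi_setting.rate_le_general pcsi_setting.intro)

theorem theorem2:
  fixes K M :: nat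
  assumes "2 \<le> M" and "M \<le> K"
  shows "((real K + 1) / 2 < real M \<longrightarrow>
            capacity K M = ereal (inverse (real K - real M + 1))) \<and>
         (real M \<le> (real K + 1) / 2 \<longrightarrow>
            capacity K M \<ge> ereal (inverse (real K - real M + 1))) \<and>
         scalar_linear_capacity K M = ereal (inverse (real K - real M + 1))"
proof (intro conjI impI)
  have lower: "ereal (inverse (real K - real M + 1)) \<le> capacity K M"
    using le_scalar_linear_capacity[OF assms] scalar_linear_capacity_le_capacity by (rule order_trans)
  show "scalar_linear_capacity K M = ereal (inverse (real K - real M + 1))"
    using scalar_linear_capacity_le[OF assms] le_scalar_linear_capacity[OF assms] by (rule antisym)
  show "capacity K M \<ge> ereal (inverse (real K - real M + 1))"
    by (rule lower)
  show "capacity K M = ereal (inverse (real K - real M + 1))" if "(real K + 1) / 2 < real M"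
  proof (rule antisym[OF capacity_le[OF assms] lower])
    have "real (K + 1) < real (2 * M)" using that by simp
    then have "K + 1 < 2 * M" by (simp only: of_nat_less_iff)
    then show "K + 2 \<le> 2 * M" by simp
  qed
qed

end
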